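(* Let $P$ be a countable poset, $I$ a subset of $P$, and $\{P^b,P^u,P^\infty\}$ a partition of $P$ (parts possibly empty) such that $I\cap P_{\min}\cap P^\infty=\emptyset$; $P^b$ and $P^b\cup P^u$ are lower subsets of $P_\Delta$; and $\{q\in P^u: q\le p\}$ is finite for each $p\in P^u$. Then there is a trim $P$-partition $\mathscr{X}=\{X_p\mid p\in P\}$ of the Stone space $W$ of a countable Boolean ring $R$ such that: (i) $\mathscr{X}$ is $I$-isolated; (ii) if the lower subset $Q\subseteq P^b$ has a finite foundation, then $\bigcup_{q\in Q}X_q\subseteq A$ for some $A\in R$; (iii) $\overline{X_p}$ is compact iff $p\notin P^\infty$; (iv) for any $A\in R$, $X_p\subseteq A$ for only finitely many $p\in P^u$. If $P$ has the ascending chain condition, then $\mathscr{X}$ is a complete trim $P$-partition of $W$. If $P$ is $\omega$-complete and $I$ is a clean subset of $P$, then $\mathscr{X}$ can be extended to a complete semi-trim $P$-partition of $W$ satisfying (i) to (iv). Moreover, $W$ is compact iff $P$ has a finite foundation, $P^\infty=\emptyset$ and $P^u$ is finite.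
   Context: Let $(P,\le)$ be a poset and $W$ a Stone space (the Stone space of a Boolean ring $R$, whose elements are identified with the compact open subsets of $W$). A $P$-partition of $W$ is a family $\mathscr{X}=\{X_p\mid p\in P\}$ of pairwise disjoint non-empty subsets of $W$; it is complete if their union is $W$. For $Y\subseteq W$, $T(Y)=\{p: Y\cap X_p\neq\emptyset\}$. A compact open set $A$ is $p$-trim ($t(A)=p$) if $T(A)=\{q:q\ge p\}$, trim if $p$-trim for some $p$. $\widehat P=\{p\in P: W$ contains a $p$-trim set$\}$. $\mathscr{X}$ is semi-trim if: every point of $W$ has a neighbourhood base of trim sets; if $A$ is open and $p\in T(A)\cap\widehat P$ then $A$ contains a $p$-trim subset; if $x\in X_p$ then $p=\sup_P\{t(A): A\text{ trim}, x\in A\}$; and for each $p$, every point with a neighbourhood base of $p$-trim sets lies in $X_p$. It is trim if moreover every $x\in X_p$ has a $p$-trim neighbourhood. $\mathscr{X}$ is $I$-isolated if $X_p$ has no isolated points for $p\notin I$, every point of $X_p$ is isolated in $X_p$ for $p\in I$, and $|X_p|=1$ for $p\in I\cap P_{\min}$. $I$ is clean if no element of $I$ is the least upper bound of a strictly increasing sequence in $P$. Poset notions: $P_{\min}$ is the set of minimal elements; a lower subset $Q$ satisfies $r\le q\in Q\Rightarrow r\in Q$. A finite foundation of $Q\subseteq P$ is a finite $F\subseteq P$ such that for every $q\in Q$ and $r\le q$ there is $p\in F$ with $p\le r$, and each $p\in F$ lies below some element of $Q$; $P_\Delta=\{p\in P: \{p\}$ has a finite foundation$\}$; $P$ has a finite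 foundation if $P$ itself does. Ascending chain condition: no strictly increasing sequence; $\omega$-complete: every ascending sequence has a supremum. *)

theory Defs
  imports
    "HOL-Analysis.Analysis"
    "HOL-Algebra.AbelCoset"
    "HOL-Library.Lub_Glb"
begin

section \<open>Boolean rings and their Stone spaces\<close>

text \<open>Boolean rings need not have an identity, so the library's ring locale is too strong:
  the field one of the ring record is left unconstrained. Commutativity follows from idempotence.\<close>

locale boolean_ring = abelian_group R for R (structure) +
  assumes m_closed: "\<lbrakk>x \<in> carrier R; y \<in> carrier R\<rbrakk> \<Longrightarrow> x \<otimes> y \<in> carrier R"
    and m_assoc: "\<lbrakk>x \<in> carrier R; y \<in> carrier R; z \<in> carrier R\<rbrakk>
          \<Longrightarrow> (x \<otimes> y) \<otimes> z = x \<otimes> (y \<otimes> z)"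
    and l_distr: "\<lbrakk>x \<in> carrier R; y \<in> carrier R; z \<in> carrier R\<rbrakk>
          \<Longrightarrow> (x \<oplus> y) \<otimes> z = x \<otimes> z \<oplus> y \<otimes> z"
    and r_distr: "\<lbrakk>x \<in> carrier R; y \<in> carrier R; z \<in> carrier R\<rbrakk>
          \<Longrightarrow> z \<otimes> (x \<oplus> y) = z \<otimes> x \<oplus> z \<otimes> y"
    and m_idem: "x \<in> carrier R \<Longrightarrow> x \<otimes> x = x"

text \<open>The library's ideals and prime ideals presuppose an identity as well. The Stone space of
  \<open>R\<close> consists of the prime (equivalently, maximal) ideals of \<open>R\<close>; the element \<open>a\<close> of \<open>R\<close> is
  identified with the compact open set \<open>stone_set R a\<close> of prime ideals not containing it.\<close>

definition prime_ideals :: "('a, 'm) ring_scheme \<Rightarrow> 'a set set" where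
  "prime_ideals R = {M. additive_subgroup M R \<and> M \<noteq> carrier R \<and>
     (\<forall>a\<in>M. \<forall>x\<in>carrier R. a \<otimes>\<^bsub>R\<^esub> x \<in> M \<and> x \<otimes>\<^bsub>R\<^esub> a \<in> M) \<and>
     (\<forall>x\<in>carrier R. \<forall>y\<in>carrier R. x \<otimes>\<^bsub>R\<^esub> y \<in> M \<longrightarrow> x \<in> M \<or> y \<in> M)}"

definition stone_set :: "('a, 'm) ring_scheme \<Rightarrow> 'a \<Rightarrow> 'a set set" where
  "stone_set R a = {M \<in> prime_ideals R. a \<notin> M}"

definition stone_space :: "('a, 'm) ring_scheme \<Rightarrow> 'a set topology" where
  "stone_space R = topology_generated_by (stone_set R ` carrier R)"


section \<open>Posets\<close>

text \<open>A poset is a set \<open>P\<close> of elements of an ordered type, with the induced order. Suprema in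
  \<open>P\<close> are expressed by \<open>isLub P S p\<close>.\<close>

definition min_elements :: "'p::order set \<Rightarrow> 'p set" where
  "min_elements P = {p \<in> P. \<forall>q\<in>P. q \<le> p \<longrightarrow> q = p}"

definition lower_subset :: "'p::order set \<Rightarrow> 'p set \<Rightarrow> bool" where
  "lower_subset P Q \<longleftrightarrow> Q \<subseteq> P \<and> (\<forall>q\<in>Q. \<forall>r\<in>P. r \<le> q \<longrightarrow> r \<in> Q)"

definition finite_foundation :: "'p::order set \<Rightarrow> 'p set \<Rightarrow> 'p set \<Rightarrow> bool" where
  "finite_foundation P Q F \<longleftrightarrow> finite F \<and> F \<subseteq> P \<and>
     (\<forall>q\<in>Q. \<forall>r\<in>P. r \<le> q \<longrightarrow> (\<exists>p\<in>F. p \<le> r)) \<and>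
     (\<forall>p\<in>F. \<exists>q\<in>Q. p \<le> q)"

definition has_finite_foundation :: "'p::order set \<Rightarrow> 'p set \<Rightarrow> bool" where
  "has_finite_foundation P Q \<longleftrightarrow> (\<exists>F. finite_foundation P Q F)"

definition P_Delta :: "'p::order set \<Rightarrow> 'p set" where
  "P_Delta P = {p \<in> P. has_finite_foundation P {p}}"

definition ascending_chain_condition :: "'p::order set \<Rightarrow> bool" where
  "ascending_chain_condition P \<longleftrightarrow> \<not> (\<exists>f::nat \<Rightarrow> 'p. range f \<subseteq> P \<and> strict_mono f)"

definition omega_complete :: "'p::order set \<Rightarrow> bool" where
  "omega_complete P \<longleftrightarrow>
     (\<forall>f::nat \<Rightarrow> 'p. range f \<subseteq> P \<and> mono f \<longrightarrow> (\<exists>s. isLub P (range f) s))"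

definition clean :: "'p::order set \<Rightarrow> 'p set \<Rightarrow> bool" where
  "clean P I \<longleftrightarrow>
     \<not> (\<exists>i\<in>I. \<exists>f::nat \<Rightarrow> 'p. range f \<subseteq> P \<and> strict_mono f \<and> isLub P (range f) i)"


section \<open>Partitions indexed by a poset\<close>

text \<open>Only the values of \<open>X\<close> on \<open>P\<close> matter. A partition need not cover the space.\<close>

definition poset_partition :: "'p::order set \<Rightarrow> 'w topology \<Rightarrow> ('p \<Rightarrow> 'w set) \<Rightarrow> bool" where
  "poset_partition P W X \<longleftrightarrow>
     (\<forall>p\<in>P. X p \<noteq> {} \<and> X p \<subseteq> topspace W) \<and> disjoint_family_on X P"

definition complete_partition :: "'p::order set \<Rightarrow> 'w topology \<Rightarrow> ('p \<Rightarrow> 'w set) \<Rightarrow> bool" where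
  "complete_partition P W X \<longleftrightarrow> (\<Union>p\<in>P. X p) = topspace W"

definition part_type :: "'p::order set \<Rightarrow> ('p \<Rightarrow> 'w set) \<Rightarrow> 'w set \<Rightarrow> 'p set" where
  "part_type P X Y = {p \<in> P. Y \<inter> X p \<noteq> {}}"

text \<open>\<open>trim_set P W X p A\<close> says that \<open>A\<close> is \<open>p\<close>-trim, i.e. that \<open>A\<close> is trim with \<open>t(A) = p\<close>.\<close>

definition trim_set :: "'p::order set \<Rightarrow> 'w topology \<Rightarrow> ('p \<Rightarrow> 'w set) \<Rightarrow> 'p \<Rightarrow> 'w set \<Rightarrow> bool" where
  "trim_set P W X p A \<longleftrightarrow> p \<in> P \<and> compactin W A \<and> openin W A \<and>
     part_type P X A = {q \<in> P. p \<le> q}"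

definition P_hat :: "'p::order set \<Rightarrow> 'w topology \<Rightarrow> ('p \<Rightarrow> 'w set) \<Rightarrow> 'p set" where
  "P_hat P W X = {p \<in> P. \<exists>A. trim_set P W X p A}"

definition semi_trim :: "'p::order set \<Rightarrow> 'w topology \<Rightarrow> ('p \<Rightarrow> 'w set) \<Rightarrow> bool" where
  "semi_trim P W X \<longleftrightarrow> poset_partition P W X \<and>
     (\<forall>x\<in>topspace W. neighbourhood_base_at x (\<lambda>A. \<exists>p. trim_set P W X p A) W) \<and>
     (\<forall>A p. openin W A \<and> p \<in> part_type P X A \<inter> P_hat P W X \<longrightarrow>
        (\<exists>B. trim_set P W X p B \<and> B \<subseteq> A)) \<and>
     (\<forall>p\<in>P. \<forall>x\<in>X p. isLub P {q. \<exists>A. trim_set P W X q A \<and> x \<in> A} p) \<and>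
     (\<forall>p\<in>P. \<forall>x\<in>topspace W. neighbourhood_base_at x (trim_set P W X p) W \<longrightarrow> x \<in> X p)"

definition trim :: "'p::order set \<Rightarrow> 'w topology \<Rightarrow> ('p \<Rightarrow> 'w set) \<Rightarrow> bool" where
  "trim P W X \<longleftrightarrow> semi_trim P W X \<and>
     (\<forall>p\<in>P. \<forall>x\<in>X p. \<exists>A. trim_set P W X p A \<and> x \<in> A)"

text \<open>A point \<open>x\<close> of \<open>S\<close> is isolated in \<open>S\<close> if \<open>{x}\<close> is open in the subspace \<open>S\<close>.\<close>

definition isolated_partition ::
    "'p::order set \<Rightarrow> 'p set \<Rightarrow> 'w topology \<Rightarrow> ('p \<Rightarrow> 'w set) \<Rightarrow> bool" where
  "isolated_partition P I W X \<longleftrightarrow>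
     (\<forall>p\<in>P - I. \<forall>x\<in>X p. \<not> openin (subtopology W (X p)) {x}) \<and>
     (\<forall>p\<in>I. \<forall>x\<in>X p. openin (subtopology W (X p)) {x}) \<and>
     (\<forall>p\<in>I \<inter> min_elements P. card (X p) = 1)"

definition extends_partition :: "'p::order set \<Rightarrow> ('p \<Rightarrow> 'w set) \<Rightarrow> ('p \<Rightarrow> 'w set) \<Rightarrow> bool" where
  "extends_partition P X Y \<longleftrightarrow> (\<forall>p\<in>P. X p \<subseteq> Y p)"

text \<open>Properties (i)--(iv) of a partition of the Stone space of \<open>R\<close>, relative to the parts
  \<open>Pb\<close>, \<open>Pu\<close> and \<open>Pinf\<close> of \<open>P\<close>.\<close>

definition bounded_type ::
    "'p::order set \<Rightarrow> 'p set \<Rightarrow> 'p set \<Rightarrow> 'p set \<Rightarrow> 'p set \<Rightarrow> ('a, 'm) ring_scheme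
      \<Rightarrow> ('p \<Rightarrow> 'a set set) \<Rightarrow> bool" where
  "bounded_type P I Pb Pu Pinf R X \<longleftrightarrow>
     isolated_partition P I (stone_space R) X \<and>
     (\<forall>Q. Q \<subseteq> Pb \<and> lower_subset P Q \<and> has_finite_foundation P Q \<longrightarrow>
        (\<exists>a\<in>carrier R. (\<Union>q\<in>Q. X q) \<subseteq> stone_set R a)) \<and>
     (\<forall>p\<in>P. compactin (stone_space R) (stone_space R closure_of X p) \<longleftrightarrow> p \<notin> Pinf) \<and>
     (\<forall>a\<in>carrier R. finite {p \<in> Pu. X p \<subseteq> stone_set R a})"

end

theory Submission imports Defs begin

text \<open>The points of the Stone space are the infinite paths of a forest whose nodes are labelled
  by \<open>P\<close>, with labels increasing along a path. Below a node with label \<open>p\<close> there are one (if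
  \<open>p \<in> I\<close>) or two (if \<open>p \<notin> I\<close>) nodes with label \<open>p\<close>, and one with label \<open>q\<close>, where \<open>q > p\<close> is
  the element considered at that level; every \<open>q \<in> P\<close> is considered infinitely often. The paths
  through a node with label \<open>p\<close> then form a \<open>p\<close>-trim set, if \<open>X p\<close> consists of the paths whose
  labels are eventually \<open>p\<close>. The complete semi-trim extension puts a path into the part of the
  supremum of its labels; this adds to \<open>X p\<close> only points of its closure, so the type of an open
  set does not change.

  Boundedness is controlled by the roots alone: one root for each minimal element of \<open>Pb\<close>, one for
  each element of \<open>Pu\<close>, and infinitely many for each element of \<open>Pinf\<close>. Indeed \<open>X p\<close> is contained
  in the trees whose root has a label \<open>\<le> p\<close>, and meets each of them.\<close>

section \<open>Suprema of increasing sequences\<close>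

text \<open>If no later value exceeded \<open>f m\<close>, monotonicity would make \<open>f\<close>
  constant from \<open>m\<close> on. So every index has a later one with a larger value, and
  iterating that choice gives the subsequence.\<close>

lemma mono_eventually_const_or_strict_subseq:
  fixes f :: "nat \<Rightarrow> 'p::order"
  assumes "mono f" and "\<not> (\<exists>p m. \<forall>k\<ge>m. f k = p)"
  shows "\<exists>r :: nat \<Rightarrow> nat. strict_mono r \<and> strict_mono (f \<circ> r)"
proof -
  have "\<exists>k>m. f m < f k" for m
    using assms by (metis monoD order_le_less)
  then obtain g where g: "g m > m" "f m < f (g m)" for m
    by metis
  define r where "r = rec_nat 0 (\<lambda>_. g)"
  have "strict_mono r" "strict_mono (f \<circ> r)"
    using g by (simp_all add: strict_mono_Suc_iff r_def)
  then show ?thesis by blast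
qed

lemma isLub_unique_order:
  fixes p q :: "'p::order"
  shows "isLub P S p \<Longrightarrow> isLub P S q \<Longrightarrow> p = q"
  by (meson isLubD1 isLub_le_isUb isLub_isUb order.antisym)

text \<open>Mutually cofinal sets have the same upper bounds. This serves to exchange the types of
  trim neighbourhoods for labels, and a sequence for a subsequence.\<close>

lemma isLub_cofinal:
  fixes p :: "'p::order"
  assumes "\<forall>a\<in>S. \<exists>b\<in>T. a \<le> b" "\<forall>b\<in>T. \<exists>a\<in>S. b \<le> a"
  shows "isLub P S p \<longleftrightarrow> isLub P T p"
proof -
  have "isUb P S u \<longleftrightarrow> isUb P T u" for u
    unfolding isUb_def setle_def using assms by (meson order.trans)
  then have "isUb P S = isUb P T" by blast
  then show ?thesis unfolding isLub_def by simp
qed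

section \<open>Trim partitions from labelled cylinders\<close>

text \<open>The forest enters the topological argument only through these properties. The decisive
  one is \<open>lab_full\<close>: every \<open>q\<close> above the label of a cylinder is the
  eventual label of a point in it.\<close>

locale labelled_space =
  fixes P :: "'p::order set" and W :: "'w topology"
    and cyl :: "nat \<Rightarrow> 'w \<Rightarrow> 'w set" and lab :: "nat \<Rightarrow> 'w \<Rightarrow> 'p"
  assumes cyl_self: "x \<in> topspace W \<Longrightarrow> x \<in> cyl n x"
    and cyl_open: "x \<in> topspace W \<Longrightarrow> openin W (cyl n x)"
    and cyl_compact: "x \<in> topspace W \<Longrightarrow> compactin W (cyl n x)"
    and cyl_base: "openin W U \<Longrightarrow> x \<in> U \<Longrightarrow> \<exists>n. cyl n x \<subseteq> U"
    and cyl_antimono: "x \<in> topspace W \<Longrightarrow> m \<le> n \<Longrightarrow> cyl n x \<subseteq> cyl m x"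
    and lab_in: "x \<in> topspace W \<Longrightarrow> lab n x \<in> P"
    and lab_mono: "x \<in> topspace W \<Longrightarrow> m \<le> n \<Longrightarrow> lab m x \<le> lab n x"
    and lab_cyl: "x \<in> topspace W \<Longrightarrow> y \<in> cyl n x \<Longrightarrow> lab n y = lab n x"
    and lab_full: "x \<in> topspace W \<Longrightarrow> q \<in> P \<Longrightarrow> lab n x \<le> q
           \<Longrightarrow> \<exists>y\<in>cyl n x. \<exists>m. \<forall>k\<ge>m. lab k y = q"
    and lab_below: "p \<in> P \<Longrightarrow> \<exists>x\<in>topspace W. lab 0 x \<le> p"
begin

section \<open>Cores, shells and the types of open sets\<close>

definition core :: "'p \<Rightarrow> 'w set" where
  "core p = {x \<in> topspace W. \<exists>m. \<forall>k\<ge>m. lab k x = p}"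

definition shell :: "'p \<Rightarrow> 'w set" where
  "shell p = {x \<in> topspace W. isLub P (range (\<lambda>n. lab n x)) p}"

text \<open>Allows the trim partition \<open>core\<close> and its extension \<open>shell\<close> to
  be treated at once.\<close>

definition sandwiched :: "('p \<Rightarrow> 'w set) \<Rightarrow> bool" where
  "sandwiched Z \<longleftrightarrow> (\<forall>p\<in>P. core p \<subseteq> Z p \<and> Z p \<subseteq> shell p)"

lemma cyl_subset: "x \<in> topspace W \<Longrightarrow> cyl n x \<subseteq> topspace W"
  using cyl_open openin_subset by blast

lemma lab_le_shell: "x \<in> shell p \<Longrightarrow> lab n x \<le> p"
  unfolding shell_def isLub_def leastP_def isUb_def setle_def by blast

lemma core_subset_shell: assumes "p \<in> P" shows "core p \<subseteq> shell p"
proof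
  fix x assume "x \<in> core p"
  then obtain m where x: "x \<in> topspace W" and m: "\<And>k. k \<ge> m \<Longrightarrow> lab k x = p"
    unfolding core_def by blast
  have "lab k x \<le> p" for k
    using lab_mono[OF x, of k "max k m"] m[of "max k m"] by simp
  moreover have "p \<le> u" if "range (\<lambda>n. lab n x) *<= u" for u
    using that m[of m] unfolding setle_def by auto
  ultimately show "x \<in> shell p"
    using x assms unfolding shell_def isLub_def leastP_def isUb_def setle_def setge_def by auto
qed

lemma sandwiched_core: "sandwiched core" and sandwiched_shell: "sandwiched shell"
  using core_subset_shell by (auto simp: sandwiched_def)

lemma cyl_meets_core:
  assumes "x \<in> topspace W" "q \<in> P" "lab n x \<le> q"
  shows "cyl n x \<inter> core q \<noteq> {}"
  using lab_full[OF assms] cyl_subset[OF assms(1)] unfolding core_def by blast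

lemma core_nonempty: "p \<in> P \<Longrightarrow> core p \<noteq> {}"
  using lab_below cyl_meets_core by blast

text \<open>All labels of a point of \<open>shell p\<close> are \<le> \<open>p\<close>, so each of
  its cylinders meets \<open>core p\<close>. Hence an open set that meets \<open>shell p\<close>
  meets \<open>core p\<close>, and trimness can be checked for \<open>core\<close> alone.\<close>

lemma part_type_sandwiched:
  assumes Z: "sandwiched Z" and A: "openin W A"
  shows "part_type P Z A = part_type P core A"
proof -
  have "A \<inter> core p \<noteq> {}" if p: "p \<in> P" and x: "x \<in> A" "x \<in> Z p" for p x
  proof -
    have xh: "x \<in> shell p" using Z p x unfolding sandwiched_def by blast
    then have xt: "x \<in> topspace W" by (simp add: shell_def)
    obtain n where "cyl n x \<subseteq> A" using cyl_base A x by blast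
    then show ?thesis using cyl_meets_core[OF xt p lab_le_shell[OF xh]] by blast
  qed
  then show ?thesis using Z unfolding part_type_def sandwiched_def by blast
qed

lemma trim_set_sandwiched:
  "sandwiched Z \<Longrightarrow> trim_set P W Z p A \<longleftrightarrow> trim_set P W core p A"
  unfolding trim_set_def using part_type_sandwiched by blast

text \<open>Labels only rise from \<open>lab n x\<close>, and by \<open>lab_full\<close> every
  larger element is reached. This makes cylinders trim.\<close>

lemma part_type_cyl:
  assumes x: "x \<in> topspace W"
  shows "part_type P core (cyl n x) = {q \<in> P. lab n x \<le> q}"
proof -
  have "lab n x \<le> q" if "y \<in> cyl n x" "y \<in> core q" "q \<in> P" for y q
    using that lab_cyl[OF x] lab_le_shell core_subset_shell by (metis subsetD)
  then show ?thesis using cyl_meets_core[OF x] unfolding part_type_def by blast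
qed

lemma trim_set_cyl: "x \<in> topspace W \<Longrightarrow> trim_set P W core (lab n x) (cyl n x)"
  unfolding trim_set_def using lab_in cyl_compact cyl_open part_type_cyl by blast

text \<open>A cylinder around \<open>x\<close> inside \<open>A\<close> has its own label among its
  types, so this label is among the types of \<open>A\<close>, all of which are above
  \<open>p\<close>.\<close>

lemma trim_set_lab_le:
  assumes A: "trim_set P W core p A" and x: "x \<in> A"
  shows "\<exists>n. p \<le> lab n x"
proof -
  have xt: "x \<in> topspace W" using A x openin_subset unfolding trim_set_def by blast
  obtain n where n: "cyl n x \<subseteq> A" using A x cyl_base unfolding trim_set_def by blast
  have "lab n x \<in> part_type P core (cyl n x)"
    using part_type_cyl[OF xt] lab_in[OF xt] by blast
  then have "lab n x \<in> part_type P core A" using n unfolding part_type_def by blast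
  then show ?thesis using A unfolding trim_set_def by blast
qed

lemma trim_set_core_point:
  assumes x: "x \<in> core p"
  shows "\<exists>m. \<forall>n\<ge>m. trim_set P W core p (cyl n x)"
  using x trim_set_cyl unfolding core_def by force

lemma isLub_types:
  assumes "x \<in> topspace W"
  shows "isLub P {q. \<exists>A. trim_set P W core q A \<and> x \<in> A} p
     \<longleftrightarrow> isLub P (range (\<lambda>n. lab n x)) p"
proof (rule isLub_cofinal)
  show "\<forall>a\<in>{q. \<exists>A. trim_set P W core q A \<and> x \<in> A}. \<exists>b\<in>range (\<lambda>n. lab n x). a \<le> b"
    using trim_set_lab_le by blast
  show "\<forall>b\<in>range (\<lambda>n. lab n x). \<exists>a\<in>{q. \<exists>A. trim_set P W core q A \<and> x \<in> A}. b \<le> a"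
    using trim_set_cyl cyl_self assms by blast
qed

text \<open>A \<open>p\<close>-trim set inside a cylinder forces the label of the cylinder to be
  \<le> \<open>p\<close>; conversely some label is \<ge> \<open>p\<close> by
  \<open>trim_set_lab_le\<close>. The increasing labels are therefore eventually
  \<open>p\<close>.\<close>

lemma core_if_neighbourhood_base:
  assumes x: "x \<in> topspace W" and p: "p \<in> P"
    and base: "neighbourhood_base_at x (trim_set P W core p) W"
  shows "x \<in> core p"
proof -
  have nb: "\<exists>V. trim_set P W core p V \<and> x \<in> V \<and> V \<subseteq> U" if "openin W U" "x \<in> U" for U
    using base that unfolding neighbourhood_base_at_def by blast
  have le: "lab n x \<le> p" for n
  proof -
    obtain V where V: "trim_set P W core p V" "V \<subseteq> cyl n x"
      using nb[OF cyl_open[OF x] cyl_self[OF x]] by blast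
    then have "p \<in> part_type P core V" using p unfolding trim_set_def by blast
    then have "p \<in> part_type P core (cyl n x)" using V unfolding part_type_def by blast
    then show ?thesis using part_type_cyl[OF x] by blast
  qed
  obtain m where "p \<le> lab m x"
    using nb[OF openin_topspace x] trim_set_lab_le by blast
  then have "lab k x = p" if "k \<ge> m" for k
    using le lab_mono[OF x that] by (meson order.antisym order.trans)
  then show ?thesis using x unfolding core_def by blast
qed

theorem semi_trim_sandwiched:
  assumes Z: "sandwiched Z"
  shows "semi_trim P W Z"
  unfolding semi_trim_def trim_set_sandwiched[OF Z]
proof (intro conjI ballI allI impI)
  \<comment> \<open>It suffices to see that the largest sandwiched family is disjoint, which is the
    uniqueness of suprema.\<close>
  have "disjoint_family_on shell P"
    unfolding disjoint_family_on_def shell_def using isLub_unique_order by blast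
  then have "disjoint_family_on Z P"
    using Z unfolding disjoint_family_on_def sandwiched_def by blast
  then show "poset_partition P W Z"
    using Z core_nonempty unfolding poset_partition_def sandwiched_def shell_def by blast
next
  fix x assume x: "x \<in> topspace W"
  show "neighbourhood_base_at x (\<lambda>A. \<exists>p. trim_set P W core p A) W"
    unfolding neighbourhood_base_at_def
    using cyl_base cyl_open cyl_self trim_set_cyl x by (metis order_refl)
next
  fix A p assume Ap: "openin W A \<and> p \<in> part_type P Z A \<inter> P_hat P W Z"
  then obtain x where x: "x \<in> A" "x \<in> core p"
    using part_type_sandwiched[OF Z] unfolding part_type_def by blast
  obtain n where n: "cyl n x \<subseteq> A" using cyl_base Ap x by blast
  obtain m where m: "\<forall>n\<ge>m. trim_set P W core p (cyl n x)"
    using trim_set_core_point x by blast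
  \<comment> \<open>The level is late enough both for the cylinder to fit into \<open>A\<close> and
    for its label to be \<open>p\<close>.\<close>
  have "cyl (max m n) x \<subseteq> A"
    using n cyl_antimono[of x n "max m n"] x unfolding core_def by auto
  then show "\<exists>B. trim_set P W core p B \<and> B \<subseteq> A"
    using m by (meson max.cobounded1)
next
  fix p x assume "p \<in> P" "x \<in> Z p"
  then have "x \<in> shell p" using Z unfolding sandwiched_def by blast
  then show "isLub P {q. \<exists>A. trim_set P W core q A \<and> x \<in> A} p"
    using isLub_types unfolding shell_def by blast
next
  fix p x assume p: "p \<in> P" and x: "x \<in> topspace W"
    and "neighbourhood_base_at x (trim_set P W core p) W"
  then show "x \<in> Z p"
    using core_if_neighbourhood_base[OF x p] Z p unfolding sandwiched_def by blast
qed

theorem trim_core: "trim P W core"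
proof -
  have "\<exists>A. trim_set P W core p A \<and> x \<in> A" if "x \<in> core p" for p x
    using trim_set_core_point[OF that] cyl_self that unfolding core_def by blast
  then show ?thesis
    unfolding trim_def using semi_trim_sandwiched sandwiched_core by blast
qed

section \<open>Completeness, clean subsets and isolated points\<close>

lemma mono_lab: "x \<in> topspace W \<Longrightarrow> mono (\<lambda>n. lab n x)"
  using lab_mono by (simp add: mono_def)

lemma non_core_strict_subseq:
  assumes x: "x \<in> topspace W" "\<And>p. p \<in> P \<Longrightarrow> x \<notin> core p"
  obtains r :: "nat \<Rightarrow> nat" where "strict_mono r" "strict_mono (\<lambda>n. lab (r n) x)"
proof -
  have "\<not> (\<exists>p m. \<forall>k\<ge>m. lab k x = p)"
  proof
    assume "\<exists>p m. \<forall>k\<ge>m. lab k x = p"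
    then obtain p m where "\<forall>k\<ge>m. lab k x = p" by blast
    moreover then have "p \<in> P" using lab_in x(1) by blast
    ultimately show False using x unfolding core_def by blast
  qed
  then show ?thesis
    using mono_eventually_const_or_strict_subseq[OF mono_lab[OF x(1)]] that
    unfolding comp_def by blast
qed

lemma complete_core:
  assumes "ascending_chain_condition P"
  shows "complete_partition P W core"
proof -
  have "\<exists>p\<in>P. x \<in> core p" if x: "x \<in> topspace W" for x
  proof (rule ccontr)
    assume "\<not> ?thesis"
    then obtain r :: "nat \<Rightarrow> nat" where "strict_mono (\<lambda>n. lab (r n) x)"
      using non_core_strict_subseq[OF x] by blast
    moreover have "range (\<lambda>n. lab (r n) x) \<subseteq> P" using lab_in[OF x] by blast
    ultimately show False using assms unfolding ascending_chain_condition_def by blast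
  qed
  then show ?thesis unfolding complete_partition_def core_def by blast
qed

lemma complete_shell:
  assumes "omega_complete P"
  shows "complete_partition P W shell"
proof -
  have "\<exists>p\<in>P. x \<in> shell p" if x: "x \<in> topspace W" for x
  proof -
    have "range (\<lambda>n. lab n x) \<subseteq> P \<and> mono (\<lambda>n. lab n x)"
      using lab_in mono_lab x by blast
    then obtain p where "isLub P (range (\<lambda>n. lab n x)) p"
      using assms unfolding omega_complete_def by blast
    then show ?thesis using x isLubD1 unfolding shell_def isLub_def leastP_def isUb_def by blast
  qed
  then show ?thesis unfolding complete_partition_def shell_def by blast
qed

text \<open>A point of \<open>shell p\<close> outside \<open>core p\<close> would exhibit
  \<open>p\<close> as the supremum of a strictly increasing subsequence of its labels.\<close>

lemma shell_clean:
  assumes "clean P I" "p \<in> I" "I \<subseteq> P"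
  shows "shell p = core p"
proof
  show "core p \<subseteq> shell p" using core_subset_shell assms by blast
  show "shell p \<subseteq> core p"
  proof (rule subsetI, rule ccontr)
    fix x assume xh: "x \<in> shell p" and xc: "x \<notin> core p"
    then have x: "x \<in> topspace W" unfolding shell_def by blast
    \<comment> \<open>Membership in another core would give the labels of \<open>x\<close> a second
      supremum.\<close>
    have "x \<notin> core q" if "q \<in> P" for q
      using xh xc core_subset_shell[OF that] isLub_unique_order unfolding shell_def by blast
    then obtain r :: "nat \<Rightarrow> nat" where r: "strict_mono r" "strict_mono (\<lambda>n. lab (r n) x)"
      using non_core_strict_subseq[OF x] by blast
    have "isLub P (range (\<lambda>n. lab (r n) x)) p \<longleftrightarrow> isLub P (range (\<lambda>n. lab n x)) p"
    proof (rule isLub_cofinal)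
      show "\<forall>b\<in>range (\<lambda>n. lab n x). \<exists>a\<in>range (\<lambda>n. lab (r n) x). b \<le> a"
        using lab_mono[OF x] seq_suble[OF r(1)] by blast
    qed blast
    then have "isLub P (range (\<lambda>n. lab (r n) x)) p" using xh unfolding shell_def by blast
    moreover have "range (\<lambda>n. lab (r n) x) \<subseteq> P" using lab_in[OF x] by blast
    ultimately show False using assms r(2) unfolding clean_def by blast
  qed
qed

text \<open>A point of \<open>Z p\<close> outside \<open>core p\<close> is a limit of
  \<open>core p\<close>. For \<open>p \<notin> I\<close> this does no harm, and \<open>lim\<close>
  treats the core points; for \<open>p \<in> I\<close> such points would not be isolated, and
  \<open>ZI\<close> excludes them.\<close>

lemma isolated_sandwiched:
  assumes Z: "sandwiched Z" and I: "I \<subseteq> P"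
    and ZI: "\<And>p. p \<in> I \<Longrightarrow> Z p = core p"
    and lim: "\<And>p x n. p \<in> P - I \<Longrightarrow> x \<in> core p \<Longrightarrow> \<exists>y\<in>cyl n x \<inter> core p. y \<noteq> x"
    and iso: "\<And>p x. p \<in> I \<Longrightarrow> x \<in> core p \<Longrightarrow> \<exists>n. cyl n x \<inter> core p \<subseteq> {x}"
    and single: "\<And>p. p \<in> I \<inter> min_elements P \<Longrightarrow> card (core p) = 1"
  shows "isolated_partition P I W Z"
  unfolding isolated_partition_def
proof (intro conjI ballI)
  fix p x assume p: "p \<in> P - I" and x: "x \<in> Z p"
  then have xh: "x \<in> shell p" and sub: "core p \<subseteq> Z p" using Z unfolding sandwiched_def by blast+
  then have xt: "x \<in> topspace W" unfolding shell_def by blast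
  show "\<not> openin (subtopology W (Z p)) {x}"
  proof
    assume "openin (subtopology W (Z p)) {x}"
    then obtain U where U: "openin W U" "{x} = U \<inter> Z p"
      unfolding openin_subtopology by blast
    then obtain n where n: "cyl n x \<subseteq> U" using cyl_base by blast
    have "\<exists>y\<in>cyl n x \<inter> core p. y \<noteq> x"
    proof (cases "x \<in> core p")
      case True
      then show ?thesis using lim p by blast
    next
      case False
      have "cyl n x \<inter> core p \<noteq> {}"
        using cyl_meets_core[OF xt _ lab_le_shell[OF xh]] p by blast
      then show ?thesis using False by (metis IntD2 equals0I)
    qed
    then show False using n U sub by blast
  qed
next
  fix p x assume p: "p \<in> I" and x: "x \<in> Z p"
  then have xc: "x \<in> core p" and xt: "x \<in> topspace W" using ZI unfolding core_def by blast+
  then obtain n where "cyl n x \<inter> core p \<subseteq> {x}" using iso p by blast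
  then have "{x} = cyl n x \<inter> Z p" using ZI[OF p] xc cyl_self[OF xt] by blast
  then show "openin (subtopology W (Z p)) {x}"
    unfolding openin_subtopology using cyl_open[OF xt] by blast
next
  fix p assume "p \<in> I \<inter> min_elements P"
  then show "card (Z p) = 1" using single ZI by simp
qed

end

section \<open>Stone spaces of rings of sets\<close>

lemma prime_ideals_mult_iff:
  assumes "boolean_ring R" "M \<in> prime_ideals R" "a \<in> carrier R" "b \<in> carrier R"
  shows "a \<otimes>\<^bsub>R\<^esub> b \<in> M \<longleftrightarrow> a \<in> M \<or> b \<in> M"
  using assms unfolding prime_ideals_def by blast

lemma topspace_stone_space: "topspace (stone_space R) = prime_ideals R"
proof -
  have "\<exists>a\<in>carrier R. a \<notin> M" if "M \<in> prime_ideals R" for M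
    using that additive_subgroup.a_subset unfolding prime_ideals_def by blast
  then show ?thesis
    unfolding stone_space_def by (auto simp: stone_set_def)
qed

lemma openin_stone_set: "a \<in> carrier R \<Longrightarrow> openin (stone_space R) (stone_set R a)"
  unfolding stone_space_def by (simp add: topology_generated_by_Basis)

text \<open>By primality the sets \<open>stone_set R a\<close> are closed under binary intersection,
  so the generating family is a base.\<close>

lemma stone_set_base:
  assumes R: "boolean_ring R" and U: "openin (stone_space R) U" "M \<in> U"
  shows "\<exists>a\<in>carrier R. M \<in> stone_set R a \<and> stone_set R a \<subseteq> U"
proof -
  interpret boolean_ring R by (fact R)
  have "generate_topology_on (stone_set R ` carrier R) U"
    using U(1) unfolding stone_space_def openin_topology_generated_by_iff .
  then show ?thesis using U(2)
  proof (induction rule: generate_topology_on.induct)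
    case (Int U V)
    then obtain a b where ab: "a \<in> carrier R" "M \<in> stone_set R a" "stone_set R a \<subseteq> U"
      "b \<in> carrier R" "M \<in> stone_set R b" "stone_set R b \<subseteq> V" by blast
    have "stone_set R (a \<otimes>\<^bsub>R\<^esub> b) = stone_set R a \<inter> stone_set R b"
      using ab prime_ideals_mult_iff[OF R] unfolding stone_set_def by blast
    then show ?case using ab m_closed by blast
  qed blast+
qed

text \<open>Symmetric difference and intersection, carried over to codes of the members of
  \<open>B\<close>, so that the ring consists of natural numbers whatever the points are.\<close>

definition set_ring :: "'a set set \<Rightarrow> nat ring" where
  "set_ring B = \<lparr>carrier = to_nat_on B ` B,
     mult = (\<lambda>a b. to_nat_on B (from_nat_into B a \<inter> from_nat_into B b)),
     one = to_nat_on B {}, zero = to_nat_on B {},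
     add = (\<lambda>a b. to_nat_on B
       (from_nat_into B a - from_nat_into B b \<union> (from_nat_into B b - from_nat_into B a)))\<rparr>"

text \<open>The prime ideal that represents the point \<open>x\<close> in the Stone space.\<close>

definition ideal_at :: "'a set set \<Rightarrow> 'a \<Rightarrow> nat set" where
  "ideal_at B x = to_nat_on B ` {b \<in> B. x \<notin> b}"

text \<open>In \<open>compact\<close> the set \<open>S\<close> is an ideal. Taking for \<open>S\<close> a prime ideal shows that prime
  ideals come from points; taking the sets covered by finitely many members of an open cover shows
  that the members of \<open>B\<close> are compact.\<close>

locale compact_ring_of_sets =
  fixes B :: "'a set set"
  assumes countable: "countable B"
    and empty: "{} \<in> B"
    and Un: "b \<in> B \<Longrightarrow> c \<in> B \<Longrightarrow> b \<union> c \<in> B"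
    and Diff: "b \<in> B \<Longrightarrow> c \<in> B \<Longrightarrow> b - c \<in> B"
    and compact: "b \<in> B \<Longrightarrow> b \<notin> S \<Longrightarrow> {} \<in> S
      \<Longrightarrow> (\<And>c d. c \<in> S \<Longrightarrow> d \<in> S \<Longrightarrow> c \<union> d \<in> S)
      \<Longrightarrow> (\<And>c d. c \<in> S \<Longrightarrow> d \<in> B \<Longrightarrow> d \<subseteq> c \<Longrightarrow> d \<in> S)
      \<Longrightarrow> \<exists>x\<in>b. \<forall>c\<in>B. x \<in> c \<longrightarrow> c \<notin> S"
    and separating: "x \<in> \<Union>B \<Longrightarrow> y \<in> \<Union>B \<Longrightarrow> x \<noteq> y \<Longrightarrow> \<exists>b\<in>B. x \<in> b \<and> y \<notin> b"
begin

abbreviation R :: "nat ring" where "R \<equiv> set_ring B"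
abbreviation code :: "'a set \<Rightarrow> nat" where "code \<equiv> to_nat_on B"
abbreviation pt :: "'a \<Rightarrow> nat set" where "pt \<equiv> ideal_at B"

lemma Int: "b \<in> B \<Longrightarrow> c \<in> B \<Longrightarrow> b \<inter> c \<in> B"
  using Diff[of b "b - c"] Diff[of b c] by (simp add: Diff_Diff_Int)

lemma decode [simp]: "b \<in> B \<Longrightarrow> from_nat_into B (code b) = b"
  using countable by simp

lemma code_eq_iff [simp]: "b \<in> B \<Longrightarrow> c \<in> B \<Longrightarrow> code b = code c \<longleftrightarrow> b = c"
  using countable by simp

lemma carrier_set_ring: "carrier R = code ` B"
  and zero_set_ring [simp]: "\<zero>\<^bsub>R\<^esub> = code {}"
  by (simp_all add: set_ring_def)

lemma mult_code [simp]: "b \<in> B \<Longrightarrow> c \<in> B \<Longrightarrow> code b \<otimes>\<^bsub>R\<^esub> code c = code (b \<inter> c)"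
  and add_code [simp]: "b \<in> B \<Longrightarrow> c \<in> B \<Longrightarrow> code b \<oplus>\<^bsub>R\<^esub> code c = code (b - c \<union> (c - b))"
  by (simp_all add: set_ring_def)

lemma code_carrier [simp]: "b \<in> B \<Longrightarrow> code b \<in> carrier R"
  by (simp add: carrier_set_ring)

lemma boolean_ring_set_ring: "boolean_ring R"
proof -
  note [simp] = Un Diff Int empty
  have "abelian_group R"
  proof (rule abelian_groupI)
    fix x assume "x \<in> carrier R"
    then show "\<exists>y\<in>carrier R. y \<oplus>\<^bsub>R\<^esub> x = \<zero>\<^bsub>R\<^esub>"
      \<comment> \<open>Every element is its own negative.\<close>
      by (intro bexI[of _ x]) (auto simp: carrier_set_ring)
  next
    fix x y z assume "x \<in> carrier R" "y \<in> carrier R" "z \<in> carrier R"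
    then obtain a b c where "a \<in> B" "b \<in> B" "c \<in> B" "x = code a" "y = code b" "z = code c"
      unfolding carrier_set_ring by blast
    moreover have "(a - b \<union> (b - a)) - c \<union> (c - (a - b \<union> (b - a)))
       = a - (b - c \<union> (c - b)) \<union> ((b - c \<union> (c - b)) - a)" by blast
    ultimately show "x \<oplus>\<^bsub>R\<^esub> y \<oplus>\<^bsub>R\<^esub> z = x \<oplus>\<^bsub>R\<^esub> (y \<oplus>\<^bsub>R\<^esub> z)" by simp
  qed (auto simp: carrier_set_ring intro!: arg_cong[of _ _ code])
  moreover have "boolean_ring_axioms R"
  proof
    fix x y z assume "x \<in> carrier R" "y \<in> carrier R" "z \<in> carrier R"
    then obtain a b c where abc: "a \<in> B" "b \<in> B" "c \<in> B" "x = code a" "y = code b" "z = code c"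
      unfolding carrier_set_ring by blast
    then show "x \<otimes>\<^bsub>R\<^esub> y \<otimes>\<^bsub>R\<^esub> z = x \<otimes>\<^bsub>R\<^esub> (y \<otimes>\<^bsub>R\<^esub> z)" by (simp add: Int_assoc)
    have "(a - b \<union> (b - a)) \<inter> c = a \<inter> c - b \<inter> c \<union> (b \<inter> c - a \<inter> c)" by blast
    then show "(x \<oplus>\<^bsub>R\<^esub> y) \<otimes>\<^bsub>R\<^esub> z = x \<otimes>\<^bsub>R\<^esub> z \<oplus>\<^bsub>R\<^esub> y \<otimes>\<^bsub>R\<^esub> z" using abc by simp
    have "c \<inter> (a - b \<union> (b - a)) = c \<inter> a - c \<inter> b \<union> (c \<inter> b - c \<inter> a)" by blast
    then show "z \<otimes>\<^bsub>R\<^esub> (x \<oplus>\<^bsub>R\<^esub> y) = z \<otimes>\<^bsub>R\<^esub> x \<oplus>\<^bsub>R\<^esub> z \<otimes>\<^bsub>R\<^esub> y" using abc by simp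
  qed (auto simp: carrier_set_ring)
  ultimately show ?thesis by (rule boolean_ring.intro)
qed

lemma countable_carrier: "countable (carrier R)"
  by simp

lemma code_in_pt: "b \<in> B \<Longrightarrow> code b \<in> pt x \<longleftrightarrow> x \<notin> b"
  unfolding ideal_at_def by auto

lemma pt_prime:
  assumes x: "x \<in> \<Union>B"
  shows "pt x \<in> prime_ideals R"
proof -
  note [simp] = Un Diff Int empty code_in_pt
  interpret boolean_ring R by (rule boolean_ring_set_ring)
  have sub: "pt x \<subseteq> carrier R" unfolding ideal_at_def carrier_set_ring by blast
  have "subgroup (pt x) (add_monoid R)"
  proof
    show "pt x \<subseteq> carrier (add_monoid R)" using sub by simp
    fix a b assume a: "a \<in> pt x" 
    then obtain a' where a': "a' \<in> B" "a = code a'" "x \<notin> a'" unfolding ideal_at_def by blast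
    have "\<ominus>\<^bsub>R\<^esub> a = a"
      by (rule minus_equality) (use a' in auto)
    then show "inv\<^bsub>add_monoid R\<^esub> a \<in> pt x" using a unfolding a_inv_def by simp
    assume "b \<in> pt x"
    then obtain b' where "b' \<in> B" "b = code b'" "x \<notin> b'" unfolding ideal_at_def by blast
    with a' show "a \<otimes>\<^bsub>add_monoid R\<^esub> b \<in> pt x" by simp
  next
    show "\<one>\<^bsub>add_monoid R\<^esub> \<in> pt x" by simp
  qed
  then have "additive_subgroup (pt x) R" by (rule additive_subgroup.intro)
  moreover have "pt x \<noteq> carrier R"
    using x code_in_pt code_carrier by blast
  moreover have "a \<otimes>\<^bsub>R\<^esub> b \<in> pt x \<longleftrightarrow> a \<in> pt x \<or> b \<in> pt x"
    if "a \<in> carrier R" "b \<in> carrier R" for a b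
    using that unfolding carrier_set_ring by auto
  ultimately show ?thesis
    using sub unfolding prime_ideals_def by blast
qed

text \<open>The members of \<open>B\<close> with code in \<open>M\<close> form an ideal
  \<open>S\<close> that misses some \<open>b\<close>. Then \<open>compact\<close> yields a point
  \<open>x\<close> none of whose neighbourhoods in \<open>B\<close> lies in \<open>S\<close>, and
  primality shows that \<open>S\<close> consists of all members missing \<open>x\<close>.\<close>

lemma prime_ideal_is_pt:
  assumes M: "M \<in> prime_ideals R"
  shows "\<exists>x\<in>\<Union>B. M = pt x"
proof -
  interpret boolean_ring R by (rule boolean_ring_set_ring)
  have subgroup: "additive_subgroup M R" using M unfolding prime_ideals_def by blast
  have sub: "M \<subseteq> carrier R" using additive_subgroup.a_subset[OF subgroup] .
  have mult: "code (b \<inter> c) \<in> M \<longleftrightarrow> code b \<in> M \<or> code c \<in> M" if "b \<in> B" "c \<in> B" for b c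
    using prime_ideals_mult_iff[OF boolean_ring_set_ring M code_carrier[OF that(1)] code_carrier[OF that(2)]]
    unfolding mult_code[OF that] .
  have zero: "code {} \<in> M" using additive_subgroup.zero_closed[OF subgroup] by simp
  have un: "code (b \<union> c) \<in> M" if bc: "b \<in> B" "c \<in> B" "code b \<in> M" "code c \<in> M" for b c
  proof -
    have "code b \<oplus>\<^bsub>R\<^esub> code c \<in> M" "code (b \<inter> c) \<in> M"
      using additive_subgroup.a_closed[OF subgroup bc(3,4)] bc mult by blast+
    then have "(code b \<oplus>\<^bsub>R\<^esub> code c) \<oplus>\<^bsub>R\<^esub> code (b \<inter> c) \<in> M"
      using additive_subgroup.a_closed[OF subgroup] by blast
    \<comment> \<open>The union is the ring sum of \<open>b\<close>, \<open>c\<close> and their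
      product.\<close>
    moreover have "(b - c \<union> (c - b)) - b \<inter> c \<union> (b \<inter> c - (b - c \<union> (c - b))) = b \<union> c" by blast
    ultimately show ?thesis using bc by (simp add: Un Diff Int)
  qed
  define S where "S = {b \<in> B. code b \<in> M}"
  have "\<exists>b\<in>B. b \<notin> S"
    using M sub unfolding S_def prime_ideals_def carrier_set_ring by auto
  then obtain b where b: "b \<in> B" "b \<notin> S" by blast
  have "\<exists>x\<in>b. \<forall>c\<in>B. x \<in> c \<longrightarrow> c \<notin> S"
  proof (rule compact[OF b])
    show "{} \<in> S" using zero empty unfolding S_def by blast
    show "c \<union> d \<in> S" if "c \<in> S" "d \<in> S" for c d
      using that un Un unfolding S_def by blast
    show "d \<in> S" if "c \<in> S" "d \<in> B" "d \<subseteq> c" for c d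
    proof -
      have "d = c \<inter> d" using that by blast
      then show ?thesis using mult[of c d] that unfolding S_def by auto
    qed
  qed
  then obtain x where x: "x \<in> b" and xS: "\<And>c. c \<in> B \<Longrightarrow> x \<in> c \<Longrightarrow> c \<notin> S" by blast
  have "code c \<in> M" if c: "c \<in> B" "x \<notin> c" for c
  proof -
    \<comment> \<open>Since \<open>b - c\<close> contains \<open>x\<close> and has product zero with
      \<open>c\<close>, primality puts \<open>c\<close> into the ideal.\<close>
    have "b - c \<notin> S" using xS Diff b c x by blast
    moreover have "(b - c) \<inter> c = {}" by blast
    ultimately show ?thesis
      using mult[of "b - c" c] zero Diff b c unfolding S_def by auto
  qed
  then have "code c \<in> M \<longleftrightarrow> x \<notin> c" if "c \<in> B" for c
    using xS that unfolding S_def by blast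
  then have "M = pt x" using sub unfolding ideal_at_def carrier_set_ring by auto
  then show ?thesis using x b by blast
qed

lemma prime_ideals_eq: "prime_ideals R = pt ` \<Union>B"
proof
  show "prime_ideals R \<subseteq> pt ` \<Union>B" using prime_ideal_is_pt by fast
  show "pt ` \<Union>B \<subseteq> prime_ideals R" using pt_prime by fast
qed

lemma inj_on_pt: "inj_on pt (\<Union>B)"
proof (rule inj_onI, rule ccontr)
  fix x y assume "x \<in> \<Union>B" "y \<in> \<Union>B" "pt x = pt y" "x \<noteq> y"
  then obtain b where b: "b \<in> B" "x \<in> b" "y \<notin> b" using separating by blast
  then show False using code_in_pt[of b x] code_in_pt[of b y] \<open>pt x = pt y\<close> by simp
qed

section \<open>The members of \<open>B\<close> as a base of compact open and closed sets\<close>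

lemma stone_set_code: "b \<in> B \<Longrightarrow> stone_set R (code b) = pt ` b"
  by (auto simp: stone_set_def prime_ideals_eq code_in_pt)

lemma openin_pt_image: "b \<in> B \<Longrightarrow> openin (stone_space R) (pt ` b)"
  using openin_stone_set[of "code b" R] stone_set_code by simp

lemma pt_base:
  assumes "openin (stone_space R) U" "pt x \<in> U" "x \<in> \<Union>B"
  shows "\<exists>b\<in>B. x \<in> b \<and> pt ` b \<subseteq> U"
proof -
  obtain b where b: "b \<in> B" "pt x \<in> stone_set R (code b)" "stone_set R (code b) \<subseteq> U"
    using stone_set_base[OF boolean_ring_set_ring assms(1,2)] unfolding carrier_set_ring by blast
  then have "x \<in> b" using code_in_pt[of b x] unfolding stone_set_def by simp
  then show ?thesis using b stone_set_code[OF b(1)] by auto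
qed

lemma compactin_pt_image:
  assumes b: "b \<in> B"
  shows "compactin (stone_space R) (pt ` b)"
  unfolding compactin_def
proof (intro conjI allI impI)
  show "pt ` b \<subseteq> topspace (stone_space R)"
    using openin_subset[OF openin_pt_image[OF b]] .
  fix \<U> assume "Ball \<U> (openin (stone_space R)) \<and> pt ` b \<subseteq> \<Union>\<U>"
  then have \<U>: "\<And>U. U \<in> \<U> \<Longrightarrow> openin (stone_space R) U" and cover: "pt ` b \<subseteq> \<Union>\<U>" by auto
  define S where "S = {c \<in> B. \<exists>\<F>. finite \<F> \<and> \<F> \<subseteq> \<U> \<and> pt ` c \<subseteq> \<Union>\<F>}"
  have "b \<in> S"
  proof (rule ccontr)
    assume bS: "b \<notin> S"
    have "\<exists>x\<in>b. \<forall>c\<in>B. x \<in> c \<longrightarrow> c \<notin> S"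
    proof (rule compact[OF b bS])
      show "{} \<in> S" using empty unfolding S_def by blast
      show "c \<union> d \<in> S" if cd: "c \<in> S" "d \<in> S" for c d
      proof -
        obtain \<F> \<G> where "finite \<F>" "\<F> \<subseteq> \<U>" "pt ` c \<subseteq> \<Union>\<F>" "finite \<G>" "\<G> \<subseteq> \<U>" "pt ` d \<subseteq> \<Union>\<G>"
          using cd unfolding S_def by blast
        then have "finite (\<F> \<union> \<G>) \<and> \<F> \<union> \<G> \<subseteq> \<U> \<and> pt ` (c \<union> d) \<subseteq> \<Union>(\<F> \<union> \<G>)"
            by (simp add: image_Un le_supI1 le_supI2)
        moreover have "c \<union> d \<in> B" using cd Un unfolding S_def by blast
        ultimately show ?thesis
          unfolding S_def by (intro CollectI conjI exI[of _ "\<F> \<union> \<G>"]) simp_all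
      qed
      show "d \<in> S" if cd: "c \<in> S" "d \<in> B" "d \<subseteq> c" for c d
      proof -
        obtain \<F> where "finite \<F>" "\<F> \<subseteq> \<U>" "pt ` c \<subseteq> \<Union>\<F>"
          using cd(1) unfolding S_def by blast
        moreover have "pt ` d \<subseteq> pt ` c" using cd(3) by blast
        ultimately show ?thesis
          using cd(2) unfolding S_def by (intro CollectI conjI exI[of _ \<F>]) simp_all
      qed
    qed
    then obtain x where x: "x \<in> b" and xS: "\<And>c. c \<in> B \<Longrightarrow> x \<in> c \<Longrightarrow> c \<notin> S" by blast
    \<comment> \<open>One member of the cover contains a whole basic neighbourhood of
      \<open>x\<close>, which therefore lies in \<open>S\<close> after all.\<close>
    obtain U where U: "U \<in> \<U>" "pt x \<in> U" using cover x by blast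
    obtain c where c: "c \<in> B" "x \<in> c" "pt ` c \<subseteq> U" using pt_base[OF \<U>] U x b by blast
    then have "finite {U} \<and> {U} \<subseteq> \<U> \<and> pt ` c \<subseteq> \<Union>{U}" using U by blast
    then have "c \<in> S" using c(1) unfolding S_def by blast
    then show False using xS c by blast
  qed
  then show "\<exists>\<F>. finite \<F> \<and> \<F> \<subseteq> \<U> \<and> pt ` b \<subseteq> \<Union>\<F>" unfolding S_def by blast
qed

lemma topspace_stone_space_set_ring: "topspace (stone_space R) = pt ` \<Union>B"
  by (simp add: topspace_stone_space prime_ideals_eq)

text \<open>By closure under differences, the complement is a union of basic open sets.\<close>

lemma closedin_pt_image:
  assumes b: "b \<in> B"
  shows "closedin (stone_space R) (pt ` b)"
proof -
  have "topspace (stone_space R) - pt ` b = (\<Union>c\<in>B. pt ` (c - b))"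
  proof -
    have "pt ` (\<Union>B) - pt ` b = pt ` (\<Union>B - b)"
      using inj_on_image_set_diff[OF inj_on_pt, of "\<Union>B" b] b by blast
    then show ?thesis unfolding topspace_stone_space_set_ring by blast
  qed
  moreover have "openin (stone_space R) (\<Union>c\<in>B. pt ` (c - b))"
    using openin_pt_image Diff b by blast
  ultimately show ?thesis
    using openin_pt_image[OF b] unfolding closedin_def by (simp add: openin_subset)
qed

end

section \<open>The path space of a labelled forest\<close>

lemma finite_Union_in:
  assumes "finite T" "{} \<in> S" "\<And>c d. c \<in> S \<Longrightarrow> d \<in> S \<Longrightarrow> c \<union> d \<in> S" "\<And>t. t \<in> T \<Longrightarrow> F t \<in> S"
  shows "(\<Union>t\<in>T. F t) \<in> S"
  using assms(1,4) by (induction rule: finite_induct) (auto intro: assms)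

text \<open>A node is a pair of a label and an index that separates nodes with the same label.\<close>

locale path_forest =
  fixes P I :: "'p::order set" and Roots :: "('p \<times> nat) set" and e :: "nat \<Rightarrow> 'p"
  assumes countable_P: "countable P"
    and enum: "p \<in> P \<Longrightarrow> \<exists>m\<ge>n. e m = p"
    and Roots_label: "r \<in> Roots \<Longrightarrow> fst r \<in> P"
    and Roots_below: "p \<in> P \<Longrightarrow> \<exists>r\<in>Roots. fst r \<le> p"
begin

text \<open>The index separates the two children with the old label. The sequence \<open>e\<close>
  may leave \<open>P\<close>, so a rise of the label asks for \<open>e n \<in> P\<close>.\<close>

definition step :: "nat \<Rightarrow> 'p \<times> nat \<Rightarrow> 'p \<times> nat \<Rightarrow> bool" where
  "step n r s \<longleftrightarrow> fst s = fst r \<and> (snd s = 0 \<or> snd s = 1 \<and> fst r \<notin> I)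
     \<or> s = (e n, 0) \<and> e n \<in> P \<and> fst r < e n"

definition V :: "(nat \<Rightarrow> 'p \<times> nat) set" where
  "V = {f. f 0 \<in> Roots \<and> (\<forall>n. step n (f n) (f (Suc n)))}"

definition C :: "nat \<Rightarrow> (nat \<Rightarrow> 'p \<times> nat) \<Rightarrow> (nat \<Rightarrow> 'p \<times> nat) set" where
  "C n f = {g \<in> V. \<forall>i\<le>n. g i = f i}"

text \<open>Sets of paths decided at a finite level and using finitely many roots. As every node has
  finitely many children, these become the compact open sets.\<close>

definition B :: "(nat \<Rightarrow> 'p \<times> nat) set set" where
  "B = {b. b \<subseteq> V \<and> finite ((\<lambda>f. f 0) ` b) \<and> (\<exists>n. \<forall>f\<in>b. C n f \<subseteq> b)}"

lemma V_root: "f \<in> V \<Longrightarrow> f 0 \<in> Roots" and V_step: "f \<in> V \<Longrightarrow> step n (f n) (f (Suc n))"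
  by (simp_all add: V_def)

lemma C_self: "f \<in> V \<Longrightarrow> f \<in> C n f" and C_subset: "C n f \<subseteq> V"
  by (auto simp: C_def)

lemma C_antimono: "m \<le> n \<Longrightarrow> C n f \<subseteq> C m f"
  by (auto simp: C_def)

lemma C_cong: "g \<in> C n f \<Longrightarrow> C n g = C n f"
  by (auto simp: C_def)

section \<open>Labels along a path and paths with a given eventual label\<close>

lemma label_in: "f \<in> V \<Longrightarrow> fst (f n) \<in> P"
proof (induction n)
  case (Suc n)
  then show ?case using V_step[of f n] unfolding step_def by auto
qed (simp add: V_root Roots_label)

lemma label_mono: "f \<in> V \<Longrightarrow> m \<le> n \<Longrightarrow> fst (f m) \<le> fst (f n)"
proof (rule lift_Suc_mono_le)
  fix n assume "f \<in> V"
  then show "fst (f n) \<le> fst (f (Suc n))"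
    using V_step[of f n] unfolding step_def by auto
qed auto

lemma label_below_eventual:
  assumes f: "f \<in> V" and ev: "\<forall>k\<ge>m. fst (f k) = p"
  shows "fst (f n) \<le> p"
  using label_mono[OF f, of n "max m n"] ev by simp

lemma exists_path_to:
  assumes f: "f \<in> V" and q: "q \<in> P" "fst (f n) \<le> q"
  shows "\<exists>g\<in>C n f. \<exists>m. \<forall>k\<ge>m. fst (g k) = q"
proof -
  obtain m where m: "m \<ge> n" "e m = q" using enum q(1) by blast
  \<comment> \<open>Follow \<open>f\<close> to level \<open>n\<close>, wait with unchanged label
    until \<open>q\<close> is on offer at level \<open>m\<close>, then stay at
    \<open>q\<close>.\<close>
  define g where "g i = (if i \<le> n then f i else if i \<le> m then (fst (f n), 0) else (q, 0))" for i
  have "step i (g i) (g (Suc i))" for i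
  proof -
    consider "Suc i \<le> n" | "n \<le> i" "Suc i \<le> m" | "i = m" | "m < i" using m(1) by linarith
    then show ?thesis
    proof cases
      case 1
      then show ?thesis using V_step[OF f] by (simp add: g_def)
    next
      case 2
      have "fst (g i) = fst (f n)" using 2 by (cases "i = n") (simp_all add: g_def)
      moreover have "g (Suc i) = (fst (f n), 0)" using 2 by (simp add: g_def)
      ultimately show ?thesis by (simp add: step_def)
    next
      case 3
      then have "fst (g i) = fst (f n)" using m(1) by (auto simp: g_def)
      moreover have "g (Suc i) = (q, 0)" using 3 m(1) by (simp add: g_def)
      ultimately show ?thesis using 3 m(2) q unfolding step_def by (auto simp: order_le_less)
    next
      case 4
      then show ?thesis using m(1) by (simp add: g_def step_def)
    qed
  qed
  moreover have "g 0 \<in> Roots" using V_root[OF f] by (simp add: g_def)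
  ultimately have "g \<in> V" by (simp add: V_def)
  then have "g \<in> C n f" by (simp add: C_def g_def)
  moreover have "\<forall>k\<ge>Suc m. fst (g k) = q" using m(1) by (simp add: g_def)
  ultimately show ?thesis by blast
qed

lemma exists_other_path:
  assumes f: "f \<in> V" and ev: "\<forall>k\<ge>m. fst (f k) = q" and q: "q \<notin> I"
  shows "\<exists>g\<in>C n f. g \<noteq> f \<and> (\<forall>k\<ge>max m n. fst (g k) = q)"
proof -
  define N where "N = max m n"
  \<comment> \<open>Leave \<open>f\<close> right after level \<open>N\<close> through the other
    child labelled \<open>q\<close>, which exists because \<open>q \<notin> I\<close>.\<close>
  define g where "g i = (if i \<le> N then f i else (q, if snd (f (Suc N)) = 0 then 1 else 0))" for i
  have "step i (g i) (g (Suc i))" for i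
  proof (cases "Suc i \<le> N")
    case True
    then show ?thesis using V_step[OF f] by (simp add: g_def)
  next
    case False
    then have "fst (g i) = q" using ev by (cases "i = N") (simp_all add: g_def N_def)
    moreover have "fst (g (Suc i)) = q" "snd (g (Suc i)) = 0 \<or> snd (g (Suc i)) = 1"
      using False by (simp_all add: g_def)
    ultimately show ?thesis using q unfolding step_def by auto
  qed
  moreover have "g 0 \<in> Roots" using V_root[OF f] by (simp add: g_def)
  ultimately have "g \<in> V" by (simp add: V_def)
  then have "g \<in> C n f" by (auto simp: C_def g_def N_def)
  moreover have "snd (g (Suc N)) \<noteq> snd (f (Suc N))" by (simp add: g_def)
  then have "g \<noteq> f" by auto
  moreover have "\<forall>k\<ge>N. fst (g k) = q" using ev by (auto simp: g_def N_def)
  ultimately show ?thesis unfolding N_def by blast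
qed

text \<open>Under a label in \<open>I\<close> the only child with the same label has index 0. Level
  \<open>n\<close> itself is excluded, since a root may have any index.\<close>

lemma constant_tail:
  assumes f: "f \<in> V" and q: "q \<in> I" and ev: "\<And>k. k \<ge> n \<Longrightarrow> fst (f k) = q" and k: "k > n"
  shows "f k = (q, 0)"
proof -
  obtain j where j: "k = Suc j" "j \<ge> n" using k less_iff_Suc_add le_add1 by metis
  then have "fst (f j) = q" "fst (f (Suc j)) = q" using ev by auto
  then have "snd (f (Suc j)) = 0" using V_step[OF f, of j] q unfolding step_def by auto
  then show ?thesis using \<open>fst (f (Suc j)) = q\<close> j by (simp add: prod_eq_iff)
qed

lemma unique_path:
  assumes f: "f \<in> V" and ev: "\<forall>k\<ge>n. fst (f k) = q" and q: "q \<in> I"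
    and g: "g \<in> C n f" "\<forall>k\<ge>m. fst (g k) = q"
  shows "g = f"
proof
  fix i
  have gV: "g \<in> V" and eq: "\<And>i. i \<le> n \<Longrightarrow> g i = f i" using g(1) by (auto simp: C_def)
  \<comment> \<open>The labels of \<open>g\<close> are squeezed between the common label
    \<open>q\<close> at level \<open>n\<close> and the eventual label \<open>q\<close>.\<close>
  have "fst (g k) = q" if "k \<ge> n" for k
    using label_mono[OF gV that] label_below_eventual[OF gV g(2), of k] eq[of n] ev by simp
  then have "g i = (q, 0)" "f i = (q, 0)" if "i > n"
    using constant_tail[OF gV q _ that] constant_tail[OF f q _ that] ev by blast+
  then show "g i = f i" using eq by (cases "i \<le> n") auto
qed

section \<open>Finite prefixes, the ring of sets \<open>B\<close> and Konig's lemma\<close>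

definition prefix :: "nat \<Rightarrow> (nat \<Rightarrow> 'p \<times> nat) \<Rightarrow> ('p \<times> nat) list" where
  "prefix n f = map f [0..<Suc n]"

lemma prefix_0: "prefix 0 f = [f 0]"
  and prefix_Suc: "prefix (Suc n) f = prefix n f @ [f (Suc n)]"
  and last_prefix: "last (prefix n f) = f n"
  by (simp_all add: prefix_def)

lemma prefix_eq_iff: "prefix n g = prefix n f \<longleftrightarrow> (\<forall>i\<le>n. g i = f i)"
  by (simp add: prefix_def less_Suc_eq_le Ball_def del: upt_Suc)

lemma C_prefix: "C n f = {g \<in> V. prefix n g = prefix n f}"
  by (simp add: C_def prefix_eq_iff)

text \<open>Each node has at most three children: two with its own label and one labelled
  \<open>e n\<close>.\<close>

lemma finite_prefixes:
  assumes "A \<subseteq> V" "finite ((\<lambda>f. f 0) ` A)"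
  shows "finite (prefix n ` A)"
proof (induction n)
  case 0
  have "prefix 0 ` A = (\<lambda>r. [r]) ` (\<lambda>f. f 0) ` A" by (simp add: image_image prefix_0)
  then show ?case using assms(2) by simp
next
  case (Suc n)
  let ?S = "SIGMA l:prefix n ` A. {(fst (last l), 0), (fst (last l), 1), (e n, 0)}"
  have "prefix (Suc n) ` A \<subseteq> (\<lambda>(l, s). l @ [s]) ` ?S"
  proof (rule image_subsetI)
    fix f assume f: "f \<in> A"
    then have "f (Suc n) \<in> {(fst (f n), 0), (fst (f n), 1), (e n, 0)}"
      using V_step[of f n] assms(1) unfolding step_def by (auto simp: prod_eq_iff)
    then have "(prefix n f, f (Suc n)) \<in> ?S" using f by (simp add: last_prefix)
    then show "prefix (Suc n) f \<in> (\<lambda>(l, s). l @ [s]) ` ?S"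
      by (rule rev_image_eqI) (simp add: prefix_Suc)
  qed
  then show ?case by (rule finite_subset) (use Suc in simp)
qed

lemma B_subset: "b \<in> B \<Longrightarrow> b \<subseteq> V" and B_roots: "b \<in> B \<Longrightarrow> finite ((\<lambda>f. f 0) ` b)"
  and B_level: "b \<in> B \<Longrightarrow> \<exists>n. \<forall>f\<in>b. C n f \<subseteq> b"
  by (simp_all add: B_def)

lemma B_Diff:
  assumes "b \<in> B" "c \<in> B"
  shows "b - c \<in> B"
proof -
  obtain m n where m: "\<And>f. f \<in> b \<Longrightarrow> C m f \<subseteq> b" and n: "\<And>f. f \<in> c \<Longrightarrow> C n f \<subseteq> c"
    using B_level assms by meson
  have "C (max m n) f \<subseteq> b - c" if f: "f \<in> b - c" for f
  proof
    fix g assume g: "g \<in> C (max m n) f"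
    then have "g \<in> b" using m C_antimono[of m "max m n" f] f by auto
    moreover have "g \<notin> c"
    proof
      assume "g \<in> c"
      \<comment> \<open>Agreement up to level \<open>n\<close> is symmetric, so
        \<open>g \<in> c\<close> would bring \<open>f\<close> into \<open>c\<close>.\<close>
      moreover have "f \<in> C n g" using g f B_subset[OF assms(1)] unfolding C_def by auto
      ultimately show False using n f by blast
    qed
    ultimately show "g \<in> b - c" by blast
  qed
  moreover have "finite ((\<lambda>f. f 0) ` (b - c))"
    by (rule finite_subset[OF _ B_roots[OF assms(1)]]) blast
  ultimately show ?thesis using B_subset[OF assms(1)] unfolding B_def by blast
qed

lemma B_Un:
  assumes "b \<in> B" "c \<in> B"
  shows "b \<union> c \<in> B"
proof -
  obtain m n where m: "\<And>f. f \<in> b \<Longrightarrow> C m f \<subseteq> b" and n: "\<And>f. f \<in> c \<Longrightarrow> C n f \<subseteq> c"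
    using B_level assms by meson
  have "C (max m n) f \<subseteq> b \<union> c" if "f \<in> b \<union> c" for f
  proof -
    have "C (max m n) f \<subseteq> C m f" "C (max m n) f \<subseteq> C n f" by (simp_all add: C_antimono)
    then show ?thesis using m[of f] n[of f] that by blast
  qed
  moreover have "finite ((\<lambda>f. f 0) ` (b \<union> c))"
    using B_roots assms by (simp add: image_Un)
  ultimately show ?thesis
    using B_subset[OF assms(1)] B_subset[OF assms(2)] unfolding B_def by blast
qed

lemma rootset_in_B:
  assumes "finite F"
  shows "{f \<in> V. f 0 \<in> F} \<in> B"
proof -
  have "finite ((\<lambda>f. f 0) ` {f \<in> V. f 0 \<in> F})"
    by (rule finite_subset[OF _ assms]) blast
  moreover have "C 0 f \<subseteq> {f \<in> V. f 0 \<in> F}" if "f 0 \<in> F" for f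
    using that by (auto simp: C_def)
  ultimately show ?thesis unfolding B_def by blast
qed

lemma empty_in_B: "{} \<in> B"
  by (simp add: B_def)

lemma C_in_B: "C n f \<in> B"
proof -
  have "(\<lambda>f. f 0) ` C n f \<subseteq> {f 0}" by (auto simp: C_def)
  then have "finite ((\<lambda>f. f 0) ` C n f)" by (rule finite_subset) simp
  then show ?thesis using C_subset C_cong[of _ n f] unfolding B_def by blast
qed

lemma Union_B: "\<Union>B = V"
  using B_subset C_in_B C_self by blast

text \<open>A member of \<open>B\<close> is determined by a level and a finite set of prefixes of
  that length over a countable alphabet.\<close>

lemma countable_B: "countable B"
proof -
  let ?L = "{S. finite S \<and> S \<subseteq> lists (P \<times> (UNIV :: nat set))}"
  have "B \<subseteq> (\<Union>n. (\<lambda>S. {f \<in> V. prefix n f \<in> S}) ` ?L)"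
  proof
    fix b assume b: "b \<in> B"
    obtain n where n: "\<And>f. f \<in> b \<Longrightarrow> C n f \<subseteq> b" using B_level[OF b] by blast
    have "b = {f \<in> V. prefix n f \<in> prefix n ` b}"
      using n B_subset[OF b] unfolding C_prefix by blast
    moreover have "prefix n ` b \<subseteq> lists (P \<times> UNIV)"
    proof (intro image_subsetI in_listsI ballI)
      fix f r assume "f \<in> b" "r \<in> set (prefix n f)"
      then show "r \<in> P \<times> UNIV"
        using B_subset[OF b] label_in unfolding prefix_def by (auto simp: mem_Times_iff)
    qed
    moreover have "finite (prefix n ` b)"
      using finite_prefixes B_subset B_roots b by blast
    ultimately show "b \<in> (\<Union>n. (\<lambda>S. {f \<in> V. prefix n f \<in> S}) ` ?L)" by blast
  qed
  moreover have "countable ?L"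
    using countable_P by (intro countable_Collect_finite_subset countable_lists) simp
  ultimately show ?thesis by (meson countable_UN countable_image countableI_type countable_subset)
qed

text \<open>Konig's lemma for an ideal \<open>S\<close>: a set outside \<open>S\<close> has, at each
  level, a piece outside \<open>S\<close>, because there are finitely many pieces. Nested pieces
  outside \<open>S\<close> converge to the path sought.\<close>

lemma konig:
  assumes b: "b \<in> B" "b \<notin> S" and empty: "{} \<in> S"
    and un: "\<And>c d. c \<in> S \<Longrightarrow> d \<in> S \<Longrightarrow> c \<union> d \<in> S"
    and down: "\<And>c d. c \<in> S \<Longrightarrow> d \<in> B \<Longrightarrow> d \<subseteq> c \<Longrightarrow> d \<in> S"
  shows "\<exists>f\<in>b. \<forall>c\<in>B. f \<in> c \<longrightarrow> c \<notin> S"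
proof -
  have B_Int: "C n f \<inter> c \<in> B" if "c \<in> B" for n f c
    using B_Diff[OF that B_Diff[OF that C_in_B[of n f]]]
    by (simp add: Diff_Diff_Int Int_commute)
  have split: "\<exists>f\<in>c. C n f \<inter> c \<notin> S" if c: "c \<in> B" "c \<notin> S" for c n
  proof (rule ccontr)
    assume "\<not> ?thesis"
    have "{g \<in> c. prefix n g = l} \<in> S" if l: "l \<in> prefix n ` c" for l
    proof -
      obtain f where f: "f \<in> c" "l = prefix n f" using l by blast
      then have "{g \<in> c. prefix n g = l} = C n f \<inter> c"
        using B_subset[OF c(1)] unfolding C_prefix by blast
      then show ?thesis using \<open>\<not> (\<exists>f\<in>c. C n f \<inter> c \<notin> S)\<close> f by auto
    qed
    moreover have "finite (prefix n ` c)"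
      using finite_prefixes[OF B_subset[OF c(1)] B_roots[OF c(1)]] .
    ultimately have "(\<Union>l\<in>prefix n ` c. {g \<in> c. prefix n g = l}) \<in> S"
      using empty un by (intro finite_Union_in) auto
    moreover have "(\<Union>l\<in>prefix n ` c. {g \<in> c. prefix n g = l}) = c" by blast
    ultimately show False using c by simp
  qed
  \<comment> \<open>\<open>F n\<close> represents the chosen piece at level \<open>n\<close>; the
    next piece is found by splitting the current one.\<close>
  have "\<exists>F. \<forall>n. (F n \<in> b \<and> C n (F n) \<inter> b \<notin> S) \<and> F (Suc n) \<in> C n (F n)"
  proof (rule dependent_nat_choice)
    show "\<exists>f. f \<in> b \<and> C 0 f \<inter> b \<notin> S" using split[OF b] by blast
    fix f n assume f: "f \<in> b \<and> C n f \<inter> b \<notin> S"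
    then have "f \<in> V" using B_subset[OF b(1)] by blast
    then obtain g where g: "g \<in> C n f \<inter> b" "C (Suc n) g \<inter> (C n f \<inter> b) \<notin> S"
      using split[OF B_Int[OF b(1)], of n f "Suc n"] f by blast
    have "C (Suc n) g \<subseteq> C n f" using C_antimono[of n "Suc n" g] C_cong[of g n f] g by auto
    then have "C (Suc n) g \<inter> (C n f \<inter> b) = C (Suc n) g \<inter> b" by blast
    then show "\<exists>g. (g \<in> b \<and> C (Suc n) g \<inter> b \<notin> S) \<and> g \<in> C n f" using g by auto
  qed
  then obtain F where F: "\<And>n. F n \<in> b" "\<And>n. C n (F n) \<inter> b \<notin> S" "\<And>n. F (Suc n) \<in> C n (F n)"
    by blast
  \<comment> \<open>The diagonal is the limit path: later choices no longer change level
    \<open>i\<close>.\<close>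
  define f where "f i = F i i" for i
  have agree: "F n i = f i" if "i \<le> n" for i n
    using that
  proof (induction rule: dec_induct)
    case (step n)
    then show ?case using F(3)[of n] by (simp add: C_def)
  qed (simp add: f_def)
  have FV: "F n \<in> V" for n using F(1) B_subset[OF b(1)] by blast
  have "step n (f n) (f (Suc n))" for n
    using V_step[OF FV[of "Suc n"], of n] agree[of n "Suc n"] agree[of "Suc n" "Suc n"] by simp
  moreover have "f 0 \<in> Roots" using V_root[OF FV, of 0] by (simp add: f_def)
  ultimately have fV: "f \<in> V" by (simp add: V_def)
  then have fC: "f \<in> C n (F n)" for n using agree by (simp add: C_def)
  \<comment> \<open>Membership in \<open>b\<close> is decided at some level \<open>n\<close>, where
    \<open>f\<close> agrees with \<open>F n\<close>.\<close>
  have "f \<in> b" using B_level[OF b(1)] F(1) fC by blast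
  moreover have "c \<notin> S" if c: "c \<in> B" "f \<in> c" for c
  proof
    assume cS: "c \<in> S"
    obtain n where "C n f \<subseteq> c" using B_level c by blast
    \<comment> \<open>The cylinder of \<open>f\<close> at this level is that of \<open>F n\<close>,
      whose trace on \<open>b\<close> is outside \<open>S\<close>.\<close>
    then have "C n f \<inter> b \<in> S" using down[OF cS B_Int[OF b(1)]] by blast
    then show False using F(2)[of n] C_cong[OF fC] by simp
  qed
  ultimately show ?thesis by blast
qed

sublocale compact_ring_of_sets B
proof
  fix f g assume "f \<in> \<Union>B" "g \<in> \<Union>B" and ne: "f \<noteq> g"
  then have "f \<in> V" using Union_B by blast
  obtain n where "f n \<noteq> g n" using ne by blast
  then have "g \<notin> C n f" by (auto simp: C_def)
  then show "\<exists>b\<in>B. f \<in> b \<and> g \<notin> b"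
    using C_in_B[of n f] C_self[OF \<open>f \<in> V\<close>, of n] by blast
qed (fact countable_B empty_in_B B_Un B_Diff konig)+

section \<open>The Stone space of the forest as a labelled space\<close>

abbreviation W :: "nat set topology" where "W \<equiv> stone_space R"

definition path :: "nat set \<Rightarrow> nat \<Rightarrow> 'p \<times> nat" where
  "path = inv_into V pt"

definition cyl :: "nat \<Rightarrow> nat set \<Rightarrow> nat set set" where
  "cyl n x = pt ` C n (path x)"

definition lab :: "nat \<Rightarrow> nat set \<Rightarrow> 'p" where
  "lab n x = fst (path x n)"

lemma topspace_W: "topspace W = pt ` V"
  using topspace_stone_space_set_ring Union_B by simp

lemma inj_pt: "inj_on pt V"
  using inj_on_pt Union_B by simp

lemma path_pt [simp]: "f \<in> V \<Longrightarrow> path (pt f) = f"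
  unfolding path_def using inj_pt by simp

lemma path_in: "x \<in> topspace W \<Longrightarrow> path x \<in> V" and pt_path: "x \<in> topspace W \<Longrightarrow> pt (path x) = x"
  unfolding topspace_W by auto

sublocale labelled_space P W cyl lab
proof
  fix x assume "x \<in> topspace W"
  then obtain f where f: "f \<in> V" "x = pt f" unfolding topspace_W by blast
  fix n
  show "x \<in> cyl n x" using f C_self unfolding cyl_def by simp
  show "openin W (cyl n x)" using f C_in_B openin_pt_image unfolding cyl_def by simp
  show "compactin W (cyl n x)" using f C_in_B compactin_pt_image unfolding cyl_def by simp
  show "cyl n x \<subseteq> cyl m x" if "m \<le> n" for m
    using C_antimono[OF that] unfolding cyl_def by blast
  show "lab n x \<in> P" using f label_in unfolding lab_def by simp
  show "lab m x \<le> lab n x" if "m \<le> n" for m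
    using f label_mono that unfolding lab_def by simp
  show "lab n y = lab n x" if "y \<in> cyl n x" for y
    using that f C_subset unfolding cyl_def lab_def C_def by auto
  show "\<exists>y\<in>cyl n x. \<exists>m. \<forall>k\<ge>m. lab k y = q" if q: "q \<in> P" "lab n x \<le> q" for q
  proof -
    have "fst (f n) \<le> q" using q(2) f by (simp add: lab_def)
    then obtain g m where g: "g \<in> C n f" "\<forall>k\<ge>m. fst (g k) = q"
      using exists_path_to[OF f(1) q(1)] by blast
    then have "g \<in> V" using C_subset by blast
    then have "\<forall>k\<ge>m. lab k (pt g) = q" using g(2) by (simp add: lab_def)
    moreover have "pt g \<in> cyl n x" using g(1) f by (simp add: cyl_def)
    ultimately show ?thesis by blast
  qed
next
  fix U x assume U: "openin W U" "x \<in> U"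
  then obtain f where f: "f \<in> V" "x = pt f" using openin_subset topspace_W by blast
  then obtain b where b: "b \<in> B" "f \<in> b" "pt ` b \<subseteq> U"
    using pt_base[OF U(1)] U(2) Union_B by blast
  obtain n where "C n f \<subseteq> b" using B_level[OF b(1)] b(2) by blast
  then have "cyl n x \<subseteq> U" using b(3) f by (auto simp: cyl_def)
  then show "\<exists>n. cyl n x \<subseteq> U" by blast
next
  fix p assume "p \<in> P"
  then obtain r where r: "r \<in> Roots" "fst r \<le> p" using Roots_below by blast
  \<comment> \<open>The path that keeps the label of its root forever.\<close>
  define f where "f n = (if n = 0 then r else (fst r, 0))" for n :: nat
  have "f \<in> V" using r by (auto simp: V_def f_def step_def)
  then show "\<exists>x\<in>topspace W. lab 0 x \<le> p"
    using r unfolding topspace_W lab_def by (auto simp: f_def intro!: bexI[of _ f])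
qed

lemma core_eq: "core p = pt ` {f \<in> V. \<exists>m. \<forall>k\<ge>m. fst (f k) = p}"
proof (intro equalityI subsetI)
  fix x assume x: "x \<in> core p"
  then obtain f where f: "f \<in> V" "x = pt f" unfolding core_def topspace_W by blast
  then have "\<exists>m. \<forall>k\<ge>m. fst (f k) = p" using x by (simp add: core_def lab_def)
  then show "x \<in> pt ` {f \<in> V. \<exists>m. \<forall>k\<ge>m. fst (f k) = p}" using f by blast
next
  fix x assume "x \<in> pt ` {f \<in> V. \<exists>m. \<forall>k\<ge>m. fst (f k) = p}"
  then obtain f where "f \<in> V" "\<exists>m. \<forall>k\<ge>m. fst (f k) = p" "x = pt f" by blast
  then show "x \<in> core p" by (simp add: core_def lab_def topspace_W)
qed

lemma pt_in_core: "f \<in> V \<Longrightarrow> pt f \<in> core p \<longleftrightarrow> (\<exists>m. \<forall>k\<ge>m. fst (f k) = p)"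
  by (simp add: core_def lab_def topspace_W)

section \<open>Roots, compactness and the boundedness properties\<close>

lemma shell_roots: "shell p \<subseteq> pt ` {f \<in> V. f 0 \<in> {r \<in> Roots. fst r \<le> p}}"
proof
  fix x assume x: "x \<in> shell p"
  then have xt: "x \<in> topspace W" by (simp add: shell_def)
  have "fst (path x 0) \<le> p" using lab_le_shell[OF x, of 0] by (simp add: lab_def)
  then show "x \<in> pt ` {f \<in> V. f 0 \<in> {r \<in> Roots. fst r \<le> p}}"
    using path_in[OF xt] pt_path[OF xt] V_root by (intro image_eqI[of _ _ "path x"]) auto
qed

text \<open>Counterpart of \<open>shell_roots\<close>: no tree whose root label is \<le>
  \<open>p\<close> can be left out, so the number of these roots decides how large the part of
  \<open>p\<close> is.\<close>

lemma root_meets_core: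
  assumes "r \<in> Roots" "fst r \<le> p" "p \<in> P"
  shows "\<exists>f\<in>V. f 0 = r \<and> pt f \<in> core p"
proof -
  define f where "f n = (if n = 0 then r else (fst r, 0))" for n :: nat
  have "f \<in> V" using assms by (auto simp: V_def f_def step_def)
  then obtain g m where g: "g \<in> C 0 f" "\<forall>k\<ge>m. fst (g k) = p"
    using exists_path_to[of f p 0] assms by (auto simp: f_def)
  then have "g \<in> V" "g 0 = r" by (auto simp: C_def f_def)
  then show ?thesis using g unfolding core_eq by blast
qed

text \<open>The trees over single roots are disjoint open sets covering the space, so a compact set
  meets finitely many.\<close>

lemma compact_finite_roots:
  assumes "compactin W K"
  shows "finite {r. \<exists>f\<in>V. f 0 = r \<and> pt f \<in> K}"
proof -
  let ?D = "\<lambda>r. pt ` {f \<in> V. f 0 \<in> {r}}"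
  have sub: "K \<subseteq> pt ` V" using assms compactin_subset_topspace topspace_W by metis
  have "\<And>U. U \<in> range ?D \<Longrightarrow> openin W U"
    using openin_pt_image[OF rootset_in_B] by blast
  moreover have "K \<subseteq> \<Union>(range ?D)" using sub by blast
  ultimately obtain \<F> where \<F>: "finite \<F>" "\<F> \<subseteq> range ?D" "K \<subseteq> \<Union>\<F>"
    using compactinD[OF assms, of "range ?D"] by blast
  obtain F where "finite F" "\<F> = ?D ` F"
    using finite_subset_image[OF \<F>(1,2)] by blast
  then have F: "finite F" "K \<subseteq> \<Union>(?D ` F)" using \<F>(3) by simp_all
  have "{r. \<exists>f\<in>V. f 0 = r \<and> pt f \<in> K} \<subseteq> F"
  proof
    fix r assume "r \<in> {r. \<exists>f\<in>V. f 0 = r \<and> pt f \<in> K}"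
    then obtain f where f: "f \<in> V" "f 0 = r" "pt f \<in> K" by blast
    then obtain s where s: "s \<in> F" "pt f \<in> ?D s" using F(2) by blast
    then obtain g where g: "g \<in> V" "g 0 = s" "pt f = pt g" by blast
    then have "f = g" using inj_onD[OF inj_pt] f(1) by blast
    then show "r \<in> F" using f(2) g(2) s(1) by simp
  qed
  then show ?thesis using F(1) finite_subset by blast
qed

lemma compact_space_iff: "compact_space W \<longleftrightarrow> finite Roots"
proof
  assume "compact_space W"
  then have "finite {r. \<exists>f\<in>V. f 0 = r \<and> pt f \<in> topspace W}"
    using compact_finite_roots unfolding compact_space_def by blast
  moreover have "Roots \<subseteq> {r. \<exists>f\<in>V. f 0 = r \<and> pt f \<in> topspace W}"
  proof
    fix r assume r: "r \<in> Roots"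
    obtain f where "f \<in> V" "f 0 = r" using root_meets_core[OF r order_refl Roots_label[OF r]] by blast
    then show "r \<in> {r. \<exists>f\<in>V. f 0 = r \<and> pt f \<in> topspace W}" unfolding topspace_W by blast
  qed
  ultimately show "finite Roots" using finite_subset by blast
next
  assume "finite Roots"
  then have "{f \<in> V. f 0 \<in> Roots} \<in> B" by (rule rootset_in_B)
  moreover have "{f \<in> V. f 0 \<in> Roots} = V" using V_root by blast
  ultimately show "compact_space W"
    using compactin_pt_image topspace_W unfolding compact_space_def by auto
qed

lemma isolated_partition_sandwiched:
  assumes Z: "sandwiched Z" and I: "I \<subseteq> P"
    and ZI: "\<And>p. p \<in> I \<Longrightarrow> Z p = core p"
    and single: "\<And>p r. p \<in> I \<inter> min_elements P \<Longrightarrow> r \<in> Roots \<Longrightarrow> fst r \<le> p \<Longrightarrow> r = (p, 0)"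
  shows "isolated_partition P I W Z"
proof (rule isolated_sandwiched[OF Z I ZI])
  fix p x n assume p: "p \<in> P - I" and x: "x \<in> core p"
  then obtain f m where f: "f \<in> V" "x = pt f" "\<forall>k\<ge>m. fst (f k) = p" unfolding core_eq by blast
  obtain g where g: "g \<in> C n f" "g \<noteq> f" "\<forall>k\<ge>max m n. fst (g k) = p"
    using exists_other_path[OF f(1,3), of n] p by blast
  then have "g \<in> V" using C_subset by blast
  then have "pt g \<in> core p" using g(3) pt_in_core by blast
  moreover have "pt g \<noteq> x" using g(2) f inj_pt \<open>g \<in> V\<close> unfolding inj_on_def by blast
  moreover have "pt g \<in> cyl n x" using g(1) f by (simp add: cyl_def)
  ultimately show "\<exists>y\<in>cyl n x \<inter> core p. y \<noteq> x" by blast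
next
  fix p x assume p: "p \<in> I" and x: "x \<in> core p"
  then obtain f n where f: "f \<in> V" "x = pt f" "\<forall>k\<ge>n. fst (f k) = p" unfolding core_eq by blast
  have "cyl n x \<inter> core p \<subseteq> {x}"
  proof
    fix y assume y: "y \<in> cyl n x \<inter> core p"
    then obtain g where g: "g \<in> C n f" "y = pt g" using f unfolding cyl_def by auto
    then have gV: "g \<in> V" using C_subset by blast
    then obtain m where "\<forall>k\<ge>m. fst (g k) = p"
      using y g(2) pt_in_core by blast
    then show "y \<in> {x}" using unique_path[OF f(1,3) p g(1)] g f by simp
  qed
  then show "\<exists>n. cyl n x \<inter> core p \<subseteq> {x}" by blast
next
  fix p assume p: "p \<in> I \<inter> min_elements P"
  have "x = pt (\<lambda>_. (p, 0))" if x: "x \<in> core p" for x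
  proof -
    obtain f m where f: "f \<in> V" "x = pt f" "\<forall>k\<ge>m. fst (f k) = p"
      using x unfolding core_eq by blast
    \<comment> \<open>Minimality turns all labels into \<open>p\<close>, membership in
      \<open>I\<close> fixes the indices after the root, and \<open>single\<close> fixes the root:
      one constant path remains.\<close>
    have le: "fst (f k) \<le> p" for k using label_below_eventual[OF f(1,3)] .
    then have "fst (f k) = p" for k
      using p label_in[OF f(1)] unfolding min_elements_def by blast
    then have "f k = (p, 0)" if "k > 0" for k
      using constant_tail[OF f(1) _ _ that] p by blast
    moreover have "f 0 = (p, 0)" using single[OF p V_root[OF f(1)] le] .
    ultimately have "f k = (p, 0)" for k by (cases "k = 0") auto
    then have "f = (\<lambda>_. (p, 0))" by blast
    then show ?thesis using f by simp
  qed
  moreover have "core p \<noteq> {}" using core_nonempty p I by blast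
  ultimately have "core p = {pt (\<lambda>_. (p, 0))}" by blast
  then show "card (core p) = 1" by simp
qed

text \<open>The conditions \<open>bd\<close>, \<open>fin\<close> and \<open>Pu\<close> on the roots
  translate into the bounds for foundations, the compactness of closures, and the finiteness
  condition on \<open>Pu\<close>.\<close>

lemma bounded_type_sandwiched:
  assumes Z: "sandwiched Z" and iso: "isolated_partition P I W Z"
    and sub: "Pb \<subseteq> P" "Pu \<subseteq> P"
    and bd: "\<And>Q. Q \<subseteq> Pb \<Longrightarrow> lower_subset P Q \<Longrightarrow> has_finite_foundation P Q
               \<Longrightarrow> finite {r \<in> Roots. \<exists>q\<in>Q. fst r \<le> q}"
    and fin: "\<And>p. p \<in> P \<Longrightarrow> finite {r \<in> Roots. fst r \<le> p} \<longleftrightarrow> p \<notin> Pinf"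
    and Pu: "\<And>p. p \<in> Pu \<Longrightarrow> (p, 0) \<in> Roots"
  shows "bounded_type P I Pb Pu Pinf R Z"
  unfolding bounded_type_def
proof (intro conjI allI ballI impI iso)
  fix Q assume Q: "Q \<subseteq> Pb \<and> lower_subset P Q \<and> has_finite_foundation P Q"
  define b where "b = {f \<in> V. f 0 \<in> {r \<in> Roots. \<exists>q\<in>Q. fst r \<le> q}}"
  have "b \<in> B" unfolding b_def using bd Q by (intro rootset_in_B) blast
  moreover have "Z q \<subseteq> pt ` b" if q: "q \<in> Q" for q
  proof -
    have "Z q \<subseteq> shell q" using Z Q q sub unfolding sandwiched_def by blast
    moreover have "{f \<in> V. f 0 \<in> {r \<in> Roots. fst r \<le> q}} \<subseteq> b" unfolding b_def using q by blast
    ultimately show ?thesis using shell_roots[of q] by blast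
  qed
  ultimately show "\<exists>a\<in>carrier R. (\<Union>q\<in>Q. Z q) \<subseteq> stone_set R a"
    using stone_set_code code_carrier by (metis UN_least)
next
  fix p assume p: "p \<in> P"
  then have Zp: "core p \<subseteq> Z p" "Z p \<subseteq> shell p" using Z unfolding sandwiched_def by blast+
  \<comment> \<open>A compact closure meets finitely many trees, and it meets all those with root
    label \<le> \<open>p\<close>. Conversely, finitely many such trees form a compact closed set
    containing \<open>Z p\<close>.\<close>
  have "compactin W (W closure_of Z p) \<longleftrightarrow> finite {r \<in> Roots. fst r \<le> p}"
  proof
    assume K: "compactin W (W closure_of Z p)"
    have "core p \<subseteq> W closure_of Z p"
      using Zp closure_of_subset[of "Z p" W] unfolding shell_def by blast
    then have "{r \<in> Roots. fst r \<le> p} \<subseteq> {r. \<exists>f\<in>V. f 0 = r \<and> pt f \<in> W closure_of Z p}"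
      using root_meets_core[OF _ _ p] by blast
    then show "finite {r \<in> Roots. fst r \<le> p}"
      using compact_finite_roots[OF K] finite_subset by blast
  next
    assume "finite {r \<in> Roots. fst r \<le> p}"
    then have b: "{f \<in> V. f 0 \<in> {r \<in> Roots. fst r \<le> p}} \<in> B" by (rule rootset_in_B)
    have "W closure_of Z p \<subseteq> pt ` {f \<in> V. f 0 \<in> {r \<in> Roots. fst r \<le> p}}"
      using Zp shell_roots[of p] closedin_pt_image[OF b] by (meson closure_of_minimal subset_trans)
    then show "compactin W (W closure_of Z p)"
      using closed_compactin[OF compactin_pt_image[OF b]] closedin_closure_of by blast
  qed
  then show "compactin W (W closure_of Z p) \<longleftrightarrow> p \<notin> Pinf" using fin[OF p] by simp
next
  fix a assume "a \<in> carrier R"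
  then obtain b where b: "b \<in> B" "a = code b" unfolding carrier_set_ring by blast
  \<comment> \<open>The tree over \<open>(p, 0)\<close> meets \<open>core p\<close>, so
    \<open>b\<close> must use this root; and \<open>b\<close> uses finitely many roots.\<close>
  have "p \<in> fst ` (\<lambda>f. f 0) ` b" if p: "p \<in> Pu" "Z p \<subseteq> stone_set R a" for p
  proof -
    obtain f where f: "f \<in> V" "f 0 = (p, 0)" "pt f \<in> core p"
      using root_meets_core[OF Pu[OF p(1)]] sub(2) p(1) by auto
    have "core p \<subseteq> pt ` b"
      using Z p sub stone_set_code[OF b(1)] b(2) unfolding sandwiched_def by blast
    then obtain g where "g \<in> b" "pt f = pt g" using f(3) by blast
    then have "f \<in> b" using inj_pt f(1) B_subset[OF b(1)] unfolding inj_on_def by blast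
    then show ?thesis using f(2) by (metis fst_conv image_eqI)
  qed
  then have "{p \<in> Pu. Z p \<subseteq> stone_set R a} \<subseteq> fst ` (\<lambda>f. f 0) ` b" by blast
  then show "finite {p \<in> Pu. Z p \<subseteq> stone_set R a}"
    using B_roots[OF b(1)] finite_subset by blast
qed

end

section \<open>Finite foundations and the choice of the roots\<close>

lemma P_DeltaE:
  assumes "p \<in> P_Delta P"
  obtains F where "finite F" "F \<subseteq> P" "\<And>r. r \<in> P \<Longrightarrow> r \<le> p \<Longrightarrow> \<exists>f\<in>F. f \<le> r"
    "\<And>f. f \<in> F \<Longrightarrow> f \<le> p"
proof -
  obtain F where "finite_foundation P {p} F"
    using assms unfolding P_Delta_def has_finite_foundation_def by blast
  then show ?thesis by (intro that[of F]) (simp_all add: finite_foundation_def)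
qed

text \<open>The members below \<open>q\<close> of a foundation of \<open>p\<close> form one of
  \<open>q\<close>. So lower subsets of \<open>P_Delta P\<close> are lower in
  \<open>P\<close>.\<close>

lemma P_Delta_lower:
  assumes p: "p \<in> P_Delta P" and q: "q \<in> P" "q \<le> p"
  shows "q \<in> P_Delta P"
proof -
  obtain F where F: "finite F" "F \<subseteq> P" "\<And>r. r \<in> P \<Longrightarrow> r \<le> p \<Longrightarrow> \<exists>f\<in>F. f \<le> r"
    using P_DeltaE[OF p] by metis
  have "\<exists>f\<in>{f \<in> F. f \<le> q}. f \<le> r" if r: "r \<in> P" "r \<le> q" for r
  proof -
    obtain f where f: "f \<in> F" "f \<le> r" using F(3)[OF r(1) order.trans[OF r(2) q(2)]] by blast
    then have "f \<le> q" using order.trans[OF _ r(2)] by blast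
    then show ?thesis using f by blast
  qed
  then have "finite_foundation P {q} {f \<in> F. f \<le> q}"
    using F(1,2) unfolding finite_foundation_def by auto
  then show ?thesis using q(1) unfolding P_Delta_def has_finite_foundation_def by blast
qed

text \<open>A foundation has a member below \<open>r\<close>, which equals \<open>r\<close> by
  minimality. Finite foundations thus bound the number of minimal elements.\<close>

lemma min_elements_subset_foundation:
  assumes "finite_foundation P Q F" "r \<in> min_elements P" "q \<in> Q" "r \<le> q"
  shows "r \<in> F"
proof -
  have r: "r \<in> P" using assms(2) unfolding min_elements_def by blast
  then obtain f where "f \<in> F" "f \<le> r"
    using assms(1,3,4) unfolding finite_foundation_def by blast
  then show ?thesis using assms(1,2) unfolding finite_foundation_def min_elements_def by blast
qed

lemma finite_minimal_below:
  assumes "p \<in> P_Delta P"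
  shows "finite {r \<in> min_elements P. r \<le> p}"
proof -
  obtain F where F: "finite_foundation P {p} F"
    using assms unfolding P_Delta_def has_finite_foundation_def by blast
  have "{r \<in> min_elements P. r \<le> p} \<subseteq> F" using min_elements_subset_foundation[OF F] by blast
  then show ?thesis using F finite_subset unfolding finite_foundation_def by blast
qed

text \<open>A minimal element of a finite foundation is minimal in \<open>P\<close>, since anything
  below it lies above a member of the foundation.\<close>

lemma minimal_below:
  assumes "p \<in> P_Delta P"
  shows "\<exists>r\<in>min_elements P. r \<le> p"
proof -
  obtain F where F: "finite F" "F \<subseteq> P" "\<And>r. r \<in> P \<Longrightarrow> r \<le> p \<Longrightarrow> \<exists>f\<in>F. f \<le> r"
    "\<And>f. f \<in> F \<Longrightarrow> f \<le> p"
    using P_DeltaE[OF assms] by metis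
  have "F \<noteq> {}" using F(3)[of p] assms unfolding P_Delta_def by auto
  then obtain r where r: "r \<in> F" "\<And>f. f \<in> F \<Longrightarrow> f \<le> r \<Longrightarrow> r = f"
    using finite_has_minimal[OF F(1)] by blast
  have "q = r" if q: "q \<in> P" "q \<le> r" for q
  proof -
    obtain f where f: "f \<in> F" "f \<le> q" using F(3)[OF q(1)] q(2) F(4)[OF r(1)] by (meson order.trans)
    then have "f = r" using r(2)[of f] q(2) by (metis order.trans)
    then show ?thesis using f(2) q(2) by (simp add: order.antisym)
  qed
  then show ?thesis using r(1) F(2,4) unfolding min_elements_def by blast
qed

theorem theorem5p3:
  fixes P I Pb Pu Pinf :: "'p::order set"
  assumes "countable P"
    and "I \<subseteq> P"
    and "Pb \<union> Pu \<union> Pinf = P"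
    and "Pb \<inter> Pu = {}" "Pb \<inter> Pinf = {}" "Pu \<inter> Pinf = {}"
    and "I \<inter> min_elements P \<inter> Pinf = {}"
    and "lower_subset (P_Delta P) Pb"
    and "lower_subset (P_Delta P) (Pb \<union> Pu)"
    and "\<forall>p\<in>Pu. finite {q \<in> Pu. q \<le> p}"
  shows "\<exists>(R :: nat ring) (X :: 'p \<Rightarrow> nat set set).
    boolean_ring R \<and> countable (carrier R) \<and>
    trim P (stone_space R) X \<and>
    bounded_type P I Pb Pu Pinf R X \<and>
    (ascending_chain_condition P \<longrightarrow> complete_partition P (stone_space R) X) \<and>
    (omega_complete P \<and> clean P I \<longrightarrow>
      (\<exists>Y. extends_partition P X Y \<and> complete_partition P (stone_space R) Y \<and>
           semi_trim P (stone_space R) Y \<and> bounded_type P I Pb Pu Pinf R Y)) \<and>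
    (compact_space (stone_space R) \<longleftrightarrow>
      has_finite_foundation P P \<and> Pinf = {} \<and> finite Pu)"
proof -
  note parts = assms(3)
  \<comment> \<open>With only minimal roots in \<open>Pb\<close>, finite foundations bound the trees
    involved. Each \<open>p \<in> Pu\<close> has a root of its own that a set containing its part
    must use, and the infinitely many copies in \<open>Pinf\<close> destroy compactness.\<close>
  define Roots :: "('p \<times> nat) set" where
    "Roots = (Pb \<inter> min_elements P) \<times> {0} \<union> Pu \<times> {0} \<union> Pinf \<times> UNIV"
  \<comment> \<open>The second component of the decoded pair varies freely, so each element recurs
    infinitely often.\<close>
  define e where "e n = from_nat_into P (fst (prod_decode n))" for n
  have lower_bu: "r \<in> Pb \<union> Pu" if "p \<in> Pb \<union> Pu" "r \<in> P" "r \<le> p" for p r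
    using assms(9) P_Delta_lower[of p P r] that unfolding lower_subset_def by blast
  have lower_b: "r \<in> Pb" if "p \<in> Pb" "r \<in> P" "r \<le> p" for p r
    using assms(8) P_Delta_lower[of p P r] that unfolding lower_subset_def by blast
  have Delta: "p \<in> P_Delta P" if "p \<in> Pb \<union> Pu" for p
    using assms(9) that unfolding lower_subset_def by blast
  have Roots_P: "fst r \<in> P" if "r \<in> Roots" for r
    using that parts unfolding Roots_def by auto
  have Roots_Pinf: "(p, k) \<in> Roots" if "p \<in> Pinf" for p k using that by (simp add: Roots_def)
  have Roots_Pu: "(p, 0) \<in> Roots" if "p \<in> Pu" for p using that by (simp add: Roots_def)
  have Roots_min: "(p, 0) \<in> Roots" if "p \<in> Pb" "p \<in> min_elements P" for p
    using that by (simp add: Roots_def)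
  have Roots_cases: "snd r = 0 \<and> fst r \<in> Pu \<union> min_elements P" if "r \<in> Roots" "fst r \<notin> Pinf" for r
    using that unfolding Roots_def by auto
  interpret path_forest P I Roots e
  proof
    fix p n assume p: "p \<in> P"
    then have "e (prod_encode (to_nat_on P p, n)) = p" using assms(1) by (simp add: e_def)
    then show "\<exists>m\<ge>n. e m = p" using le_prod_encode_2 by blast
    show "\<exists>r\<in>Roots. fst r \<le> p"
    proof (cases "p \<in> Pb")
      case True
      then obtain r where r: "r \<in> min_elements P" "r \<le> p" using minimal_below Delta by blast
      then have "r \<in> Pb" using lower_b[OF True] unfolding min_elements_def by blast
      then show ?thesis using Roots_min[OF _ r(1)] r(2) by (metis fst_conv)
    next
      case False
      then have "(p, 0) \<in> Roots" using p parts Roots_Pinf Roots_Pu by blast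
      then show ?thesis by (metis fst_conv order_refl)
    qed
  qed (use assms(1) Roots_P in auto)
  have infinite: "infinite {r \<in> Roots. fst r \<le> p}" if "p \<in> Pinf" for p
  proof
    assume "finite {r \<in> Roots. fst r \<le> p}"
    moreover have "range (Pair p) \<subseteq> {r \<in> Roots. fst r \<le> p}" using Roots_Pinf[OF that] by auto
    ultimately have "finite (range (Pair p :: nat \<Rightarrow> _))" by (rule rev_finite_subset)
    then show False using finite_imageD[of "Pair p" "UNIV :: nat set"] by (simp add: inj_on_def)
  qed
  have fin: "finite {r \<in> Roots. fst r \<le> p} \<longleftrightarrow> p \<notin> Pinf" if p: "p \<in> P" for p
  proof
    assume "p \<notin> Pinf"
    then have bu: "p \<in> Pb \<union> Pu" using p parts by blast
    \<comment> \<open>For \<open>p \<in> Pu\<close> this is assumed; for \<open>p \<in> Pb\<close>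
      the set is empty because \<open>Pb\<close> is lower.\<close>
    have "finite {q \<in> Pu. q \<le> p}"
    proof (cases "p \<in> Pu")
      case False
      then have "{q \<in> Pu. q \<le> p} = {}" using lower_b[of p] bu assms(4) parts by blast
      then show ?thesis by (metis finite.emptyI)
    qed (use assms(10) in blast)
    then have "finite (({r \<in> min_elements P. r \<le> p} \<union> {q \<in> Pu. q \<le> p}) \<times> {0::nat})"
      using finite_minimal_below[OF Delta[OF bu]] by simp
    moreover have "{r \<in> Roots. fst r \<le> p} \<subseteq> ({r \<in> min_elements P. r \<le> p} \<union> {q \<in> Pu. q \<le> p}) \<times> {0}"
    proof
      fix r assume r: "r \<in> {r \<in> Roots. fst r \<le> p}"
      then have "fst r \<in> Pb \<union> Pu" using lower_bu[OF bu] Roots_P by blast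
      then have "snd r = 0 \<and> fst r \<in> Pu \<union> min_elements P"
        using Roots_cases r assms(5,6) by blast
      then show "r \<in> ({r \<in> min_elements P. r \<le> p} \<union> {q \<in> Pu. q \<le> p}) \<times> {0}"
        using r by (auto simp: mem_Times_iff)
    qed
    ultimately show "finite {r \<in> Roots. fst r \<le> p}" by (rule rev_finite_subset)
  qed (use infinite in blast)
  have bd: "finite {r \<in> Roots. \<exists>q\<in>Q. fst r \<le> q}"
    if Q: "Q \<subseteq> Pb" "has_finite_foundation P Q" for Q
  proof -
    obtain F where F: "finite_foundation P Q F" using Q unfolding has_finite_foundation_def by blast
    have "{r \<in> Roots. \<exists>q\<in>Q. fst r \<le> q} \<subseteq> F \<times> {0}"
    proof
      fix r assume "r \<in> {r \<in> Roots. \<exists>q\<in>Q. fst r \<le> q}"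
      then obtain q where r: "r \<in> Roots" "q \<in> Q" "fst r \<le> q" by blast
      \<comment> \<open>A root label in \<open>Pb\<close> is minimal and hence belongs to the
        foundation \<open>F\<close>.\<close>
      then have b: "fst r \<in> Pb" using lower_b Q Roots_P by blast
      then have "snd r = 0 \<and> fst r \<in> min_elements P" using Roots_cases[OF r(1)] assms(4,5) by blast
      then show "r \<in> F \<times> {0}"
        using min_elements_subset_foundation[OF F _ r(2,3)] by (simp add: mem_Times_iff)
    qed
    moreover have "finite (F \<times> {0::nat})" using F by (simp add: finite_foundation_def)
    ultimately show ?thesis by (rule finite_subset)
  qed
  have single: "r = (p, 0)" if p: "p \<in> I \<inter> min_elements P" and r: "r \<in> Roots" "fst r \<le> p" for p r
  proof -
    have "fst r = p" using p r Roots_P unfolding min_elements_def by blast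
    \<comment> \<open>A minimal element of \<open>I\<close> is outside \<open>Pinf\<close>, so its
      only root has index 0.\<close>
    then show ?thesis using Roots_cases[OF r(1)] p assms(7) by (auto simp: prod_eq_iff)
  qed
  have bounded: "bounded_type P I Pb Pu Pinf R Z"
    if Z: "sandwiched Z" "\<And>p. p \<in> I \<Longrightarrow> Z p = core p" for Z
  proof (rule bounded_type_sandwiched[OF Z(1)])
    show "isolated_partition P I W Z"
      by (rule isolated_partition_sandwiched[OF Z(1) assms(2) Z(2) single])
    show "Pb \<subseteq> P" "Pu \<subseteq> P" using parts by auto
    show "finite {r \<in> Roots. \<exists>q\<in>Q. fst r \<le> q}"
      if "Q \<subseteq> Pb" "has_finite_foundation P Q" for Q using bd that .
    show "finite {r \<in> Roots. fst r \<le> p} \<longleftrightarrow> p \<notin> Pinf" if "p \<in> P" for p using fin that .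
    show "(p, 0) \<in> Roots" if "p \<in> Pu" for p using Roots_Pu that .
  qed
  have compact_iff: "compact_space W \<longleftrightarrow> has_finite_foundation P P \<and> Pinf = {} \<and> finite Pu"
    unfolding compact_space_iff
  proof
    assume fR: "finite Roots"
    \<comment> \<open>The root labels are a foundation of \<open>P\<close>, because every element
      has a root label below it.\<close>
    have "finite_foundation P P (fst ` Roots)"
      using fR Roots_P Roots_below unfolding finite_foundation_def by auto
    moreover have "finite {r \<in> Roots. fst r \<le> p}" for p using fR by simp
    then have "Pinf = {}" using infinite by blast
    moreover have "Pu \<subseteq> fst ` Roots" using Roots_Pu by force
    ultimately show "has_finite_foundation P P \<and> Pinf = {} \<and> finite Pu"
      using fR finite_subset unfolding has_finite_foundation_def by blast
  next
    assume R: "has_finite_foundation P P \<and> Pinf = {} \<and> finite Pu"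
    then obtain F where F: "finite_foundation P P F" unfolding has_finite_foundation_def by blast
    have "min_elements P \<subseteq> F"
    proof
      fix r assume r: "r \<in> min_elements P"
      then have "r \<in> P" unfolding min_elements_def by blast
      then show "r \<in> F" using min_elements_subset_foundation[OF F r _ order_refl] by blast
    qed
    then have "Roots \<subseteq> (F \<union> Pu) \<times> {0}" using R unfolding Roots_def by blast
    moreover have "finite ((F \<union> Pu) \<times> {0::nat})" using F R by (simp add: finite_foundation_def)
    ultimately show "finite Roots" by (rule finite_subset)
  qed
  show ?thesis
  proof (rule exI[of _ R], rule exI[of _ core], intro conjI impI)
    show "boolean_ring R" by (rule boolean_ring_set_ring)
    show "countable (carrier R)" by (rule countable_carrier)
    show "trim P W core" by (rule trim_core)
    show "bounded_type P I Pb Pu Pinf R core" by (rule bounded[OF sandwiched_core]) simp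
    show "complete_partition P W core" if "ascending_chain_condition P"
      using complete_core that .
    show "\<exists>Y. extends_partition P core Y \<and> complete_partition P W Y \<and>
        semi_trim P W Y \<and> bounded_type P I Pb Pu Pinf R Y" if oc: "omega_complete P \<and> clean P I"
    proof (intro exI[of _ shell] conjI)
      show "extends_partition P core shell"
        using core_subset_shell unfolding extends_partition_def by blast
      show "complete_partition P W shell" using complete_shell oc by blast
      show "semi_trim P W shell" by (rule semi_trim_sandwiched[OF sandwiched_shell])
      show "bounded_type P I Pb Pu Pinf R shell"
        \<comment> \<open>Cleanness ensures that passing to shells adds no point to a part indexed
          by \<open>I\<close>.\<close>
        by (rule bounded[OF sandwiched_shell]) (use shell_clean oc assms(2) in blast)
    qed
    show "compact_space W \<longleftrightarrow> has_finite_foundation P P \<and> Pinf = {} \<and> finite Pu"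
      by (rule compact_iff)
  qed
qed

end
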